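(* In the setting and with the notation described in the context, let $\alpha^{(k)}=\|P^{(k)}S_A(I-P^{(k)})\|$, where $P^{(k)}$ is the orthogonal projector onto $$\mathcal{W}^{(k)}=\mathrm{span}\left\{\begin{bmatrix}Q_1^{(k)} & 0 \\ 0 & Q_2^{(k)}\end{bmatrix}\right\}.$$ Suppose that each singular value $\sigma_i\in[a,b]$ of $A$ is simple, and define $$\eta_i^{(k)}=\min_{j\ne i}|\sigma_i-\tilde\sigma_j^{(k)}|,\qquad i=1,2,\ldots,n_{sv},$$ (the minimum being over $j\in\{1,\ldots,p\}$, and assumed nonzero). Then for $i=1,2,\ldots,n_{sv}$ it holds that $$\sin^2\angle(u_i,\tilde u_i^{(k)})+\sin^2\angle(v_i,\tilde v_i^{(k)})\le2\left(1+\frac{(\alpha^{(k)})^2}{(\eta_i^{(k)})^2}\right)\left(\frac{\gamma_{p+1}}{\gamma_i}\right)^{2k}\|E^{(0)}\|^2,$$ $$|\sigma_i-\tilde\sigma_i^{(k)}|\le2\|A\|\left(1+\frac{(\alpha^{(k)})^2}{(\eta_i^{(k)})^2}\right)\left(\frac{\gamma_{p+1}}{\gamma_i}\right)^{2k}\|E^{(0)}\|^2.$$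
   Context: $\|\cdot\|$ is the 2-norm; $\mathrm{span}\{M\}$ is the column space of $M$; $\angle(x,y)$ is the acute angle between the lines spanned by $x$ and $y$. Matrices. $A\in\mathbb{R}^{m\times n}$, $m\ge n$, smallest singular value $\sigma_{\min}$, $[a,b]\subset[\sigma_{\min},\|A\|]$, $0<a<b$; $n_{sv}$ is the number of singular values in $[a,b]$ counted with multiplicity. $S_A=\begin{bmatrix}0 & A^T \\ A & 0\end{bmatrix}$. With an SVD $A=U\begin{pmatrix}\Sigma \\ 0\end{pmatrix}V^T$, $U=[U_n\,|\,\hat U]$ ($U_n$ has $n$ columns), the orthogonal matrix $Q=\frac1{\sqrt2}\begin{bmatrix}V & V & 0 \\ U_n & -U_n & \sqrt2\hat U\end{bmatrix}$ satisfies $Q^TS_AQ=\mathrm{diag}(\Sigma,-\Sigma,0,\ldots,0)$. $P_{S_A}=Q_{in}Q_{in}^T+\frac12Q_{ab}Q_{ab}^T$, where $Q_{in}$ (resp. $Q_{ab}$) consists of the columns of $Q$ belonging to eigenvalues of $S_A$ in $(a,b)$ (resp. equal to $a$ or $b$). Approximate projector. $l(x)=x/\|A\|$; $\phi_d(x)=\sum_{j=0}^d\rho_{j,d}c_jT_j(x)$ with $T_j$ the Chebyshev polynomials of the first kind, $c_0=\frac1\pi(\arccos l(a)-\arccos l(b))$, $c_j=\frac2\pi\frac{\sin(j\arccos l(a))-\sin(j\arccos l(b))}{j}$ for $j>0$, and $\rho_{j,d}=\frac{(d+2-j)\sin(\frac{\pi}{d+2})\cos(\frac{j\pi}{d+2})+\cos(\frac{\pi}{d+2})\sin(\frac{j\pi}{d+2})}{(d+2)\sin\frac{\pi}{d+2}}$.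 $P=\phi_d(l(S_A))$, which has eigenvector matrix $Q$ and eigenvalues $\phi_d(l(\lambda))\in[0,1]$, $\lambda$ an eigenvalue of $S_A$. Labeling and standing assumptions. The eigenvalues of $P$ are labeled $\gamma_1\ge\gamma_2\ge\cdots\ge\gamma_{m+n}$ with corresponding eigenvalues $\lambda_i$ of $S_A$ ($\gamma_i=\phi_d(l(\lambda_i))$) and eigenvectors $q_i$, the $q_i$ being a permutation of the columns of $Q$. The degree $d$ is assumed large enough that: $\|P_{S_A}-P\|<\frac14$; $\lambda_1=\sigma_1,\ldots,\lambda_{n_{sv}}=\sigma_{n_{sv}}$ are exactly the singular values in $[a,b]$, with $\sigma_1,\ldots,\sigma_r\in(a,b)$, $\sigma_{r+1},\ldots,\sigma_{n_{sv}}\in\{a,b\}$ and $1\ge\gamma_1\ge\cdots\ge\gamma_r>\frac34>\gamma_{r+1}\ge\cdots\ge\gamma_{n_{sv}}>\frac14>\gamma_{n_{sv}+1}\ge\cdots\ge\gamma_{m+n}\ge0$; and, for the chosen subspace dimension $p\ge n_{sv}$, $\lambda_{n_{sv}+1},\ldots,\lambda_p$ are positive, so they are singular values $\sigma_{n_{sv}+1},\ldots,\sigma_p$ of $A$. Thus $q_i=\frac1{\sqrt2}\begin{bmatrix}v_i \\ u_i\end{bmatrix}$ for $i\le p$, with $v_i,u_i$ the right and left singular vectors for $\sigma_i$. Notation: $Q_p=[q_1,\ldots,q_p]$, $Q_{p,\perp}=[q_{p+1},\ldots,q_{m+n}]$. Iteration. Start from $\tilde Q^{(0)}\in\mathbb{R}^{(m+n)\times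 p}$ with orthonormal columns. For $k=1,2,\ldots$: $S^{(k)}=P\tilde Q^{(k-1)}$; QR decomposition $S^{(k)}=\tilde Q^{(k)}R^{(k)}$; $Y^{(k)}=[I_n,0]\tilde Q^{(k)}$, $Z^{(k)}=[0,I_m]\tilde Q^{(k)}$; thin QR decompositions $Y^{(k)}=Q_1^{(k)}R_1^{(k)}$, $Z^{(k)}=Q_2^{(k)}R_2^{(k)}$; $\bar A^{(k)}=(Q_2^{(k)})^TAQ_1^{(k)}$ with SVD $\bar A^{(k)}=\bar U^{(k)}\tilde\Sigma^{(k)}(\bar V^{(k)})^T$, $\tilde\Sigma^{(k)}=\mathrm{diag}(\tilde\sigma_1^{(k)},\ldots,\tilde\sigma_p^{(k)})$. The Ritz approximations are $(\tilde\sigma_i^{(k)},\tilde u_i^{(k)},\tilde v_i^{(k)})$ with $\tilde u_i^{(k)}=Q_2^{(k)}\bar U^{(k)}e_i$, $\tilde v_i^{(k)}=Q_1^{(k)}\bar V^{(k)}e_i$, labeled in the same order as $\sigma_1,\ldots,\sigma_p$ (a permutation arranging $\sigma_1,\ldots,\sigma_p$ in decreasing order also arranges $\tilde\sigma_1^{(k)},\ldots,\tilde\sigma_p^{(k)}$ in decreasing order). Further assumptions: $\gamma_p>\gamma_{p+1}$, $Q_p^T\tilde Q^{(0)}$ is invertible, and $R_1^{(k)},R_2^{(k)}$ are nonsingular. $E^{(0)}=Q_{p,\perp}^T\tilde Q^{(0)}(Q_p^T\tilde Q^{(0)})^{-1}$. *)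

theory Defs
  imports
    Complex_Main
    "HOL-Combinatorics.Permutations"
    "HOL-Computational_Algebra.Polynomial"
    "Jordan_Normal_Form.Matrix"
    "Jordan_Normal_Form.Gauss_Jordan_Elimination"
    "Jordan_Normal_Form.VS_Connect"
begin

text \<open>All matrix and vector indices start at 0, and so do the labels of eigenvalues and
  singular values: the objects labelled \<open>1, \<dots>, p\<close> on paper are those with index \<open>i < p\<close>,
  and \<open>\<gamma>\<close> at \<open>p + 1\<close> on paper is \<open>\<gamma> p\<close> here.\<close>

definition norm2_vec :: "real vec \<Rightarrow> real" where
  "norm2_vec x = sqrt (x \<bullet> x)"

text \<open>The supremum is taken over the unit ball rather than the unit sphere, so that the norm of a
  matrix without columns is 0.\<close>

definition norm2_mat :: "real mat \<Rightarrow> real" where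
  "norm2_mat M = (SUP x \<in> {x \<in> carrier_vec (dim_col M). norm2_vec x \<le> 1}. norm2_vec (M *\<^sub>v x))"

definition acute_angle :: "real vec \<Rightarrow> real vec \<Rightarrow> real" where
  "acute_angle x y = arccos (\<bar>x \<bullet> y\<bar> / (norm2_vec x * norm2_vec y))"

text \<open>The library's \<open>orthogonal_mat\<close> does not ask for normalized columns.\<close>

definition orthonormal_cols :: "real mat \<Rightarrow> bool" where
  "orthonormal_cols M \<longleftrightarrow> M\<^sup>T * M = 1\<^sub>m (dim_col M)"

text \<open>The diagonal of \<open>S\<close> need not be sorted.\<close>

definition is_svd :: "real mat \<Rightarrow> real mat \<Rightarrow> real mat \<Rightarrow> real mat \<Rightarrow> bool" where
  "is_svd M U S V \<longleftrightarrow>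
     U \<in> carrier_mat (dim_row M) (dim_row M) \<and> orthonormal_cols U \<and>
     V \<in> carrier_mat (dim_col M) (dim_col M) \<and> orthonormal_cols V \<and>
     S \<in> carrier_mat (dim_row M) (dim_col M) \<and> diagonal_mat S \<and>
     (\<forall>j < min (dim_row M) (dim_col M). S $$ (j, j) \<ge> 0) \<and>
     M = U * S * V\<^sup>T"

text \<open>Thin QR decomposition. The diagonal of \<open>R\<close> may have any signs.\<close>

definition is_thin_qr :: "real mat \<Rightarrow> real mat \<Rightarrow> real mat \<Rightarrow> bool" where
  "is_thin_qr M Q R \<longleftrightarrow>
     Q \<in> carrier_mat (dim_row M) (dim_col M) \<and> orthonormal_cols Q \<and>
     R \<in> carrier_mat (dim_col M) (dim_col M) \<and> upper_triangular R \<and>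
     M = Q * R"

definition is_orthogonal_projector :: "nat \<Rightarrow> real mat \<Rightarrow> real vec set \<Rightarrow> bool" where
  "is_orthogonal_projector N P W \<longleftrightarrow>
     P \<in> carrier_mat N N \<and>
     (\<forall>x \<in> carrier_vec N. P *\<^sub>v x \<in> W \<and> (\<forall>w \<in> W. (x - P *\<^sub>v x) \<bullet> w = 0))"

definition col_span :: "real mat \<Rightarrow> real vec set" where
  "col_span M = vec_space.col_space (dim_row M) M"

definition block_diag2 :: "real mat \<Rightarrow> real mat \<Rightarrow> real mat" where
  "block_diag2 M N =
     four_block_mat M (0\<^sub>m (dim_row M) (dim_col N)) (0\<^sub>m (dim_row N) (dim_col M)) N"

definition select_cols :: "real mat \<Rightarrow> nat list \<Rightarrow> real mat" where
  "select_cols M js = mat_of_cols (dim_row M) (map (col M) js)"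

definition aug_mat :: "real mat \<Rightarrow> real mat" where
  "aug_mat A =
     four_block_mat (0\<^sub>m (dim_col A) (dim_col A)) (A\<^sup>T) A (0\<^sub>m (dim_row A) (dim_row A))"

text \<open>Eigenvector matrix of \<open>aug_mat A\<close> built from \<open>U\<close> (of size \<open>m \<times> m\<close>) and \<open>V\<close>
  (of size \<open>n \<times> n\<close>), given by its three groups of columns, and the eigenvalue that belongs
  to column \<open>j\<close>.\<close>

definition aug_eigvecs :: "real mat \<Rightarrow> real mat \<Rightarrow> real mat" where
  "aug_eigvecs U V =
     (let m = dim_row U; n = dim_row V in
      (1 / sqrt 2) \<cdot>\<^sub>m mat_of_cols (m + n)
        (map (\<lambda>j. col V j @\<^sub>v col U j) [0..<n] @
         map (\<lambda>j. col V j @\<^sub>v - col U j) [0..<n] @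
         map (\<lambda>j. 0\<^sub>v n @\<^sub>v sqrt 2 \<cdot>\<^sub>v col U j) [n..<m]))"

definition aug_eigval :: "real mat \<Rightarrow> nat \<Rightarrow> real" where
  "aug_eigval S j =
     (let n = dim_col S in
      if j < n then S $$ (j, j)
      else if j < 2 * n then - S $$ (j - n, j - n)
      else 0)"

text \<open>Projector onto the eigenvectors with eigenvalue in the open interval, plus one half of the
  projector for the end points.\<close>

definition spectral_projector :: "real mat \<Rightarrow> (nat \<Rightarrow> real) \<Rightarrow> real \<Rightarrow> real \<Rightarrow> real mat" where
  "spectral_projector Q ev a b =
     (let Qin = select_cols Q (filter (\<lambda>j. a < ev j \<and> ev j < b) [0..<dim_col Q]);
          Qab = select_cols Q (filter (\<lambda>j. ev j = a \<or> ev j = b) [0..<dim_col Q])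
      in Qin * Qin\<^sup>T + (1/2) \<cdot>\<^sub>m (Qab * Qab\<^sup>T))"

fun cheb_poly :: "nat \<Rightarrow> real poly" where
  "cheb_poly 0 = 1"
| "cheb_poly (Suc 0) = [:0, 1:]"
| "cheb_poly (Suc (Suc j)) = [:0, 2:] * cheb_poly (Suc j) - cheb_poly j"

text \<open>Chebyshev coefficients of the indicator function of \<open>[\<alpha>, \<beta>]\<close>, a subset of \<open>[-1, 1]\<close>.\<close>

definition step_coeff :: "real \<Rightarrow> real \<Rightarrow> nat \<Rightarrow> real" where
  "step_coeff \<alpha> \<beta> j =
     (if j = 0 then (arccos \<alpha> - arccos \<beta>) / pi
      else 2 / pi * ((sin (real j * arccos \<alpha>) - sin (real j * arccos \<beta>)) / real j))"

text \<open>Jackson damping factors.\<close>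

definition jackson_factor :: "nat \<Rightarrow> nat \<Rightarrow> real" where
  "jackson_factor d j =
     ((real d + 2 - real j) * sin (pi / (real d + 2)) * cos (real j * pi / (real d + 2))
       + cos (pi / (real d + 2)) * sin (real j * pi / (real d + 2)))
     / ((real d + 2) * sin (pi / (real d + 2)))"

definition jackson_step_poly :: "nat \<Rightarrow> real \<Rightarrow> real \<Rightarrow> real poly" where
  "jackson_step_poly d \<alpha> \<beta> =
     (\<Sum>j = 0..d. Polynomial.smult (jackson_factor d j * step_coeff \<alpha> \<beta> j) (cheb_poly j))"

text \<open>Value of a polynomial at a square matrix.\<close>

definition eval_poly_mat :: "real poly \<Rightarrow> real mat \<Rightarrow> real mat" where
  "eval_poly_mat f M =
     mat (dim_row M) (dim_row M) (\<lambda>(i, j). \<Sum>e \<le> Polynomial.degree f. Polynomial.coeff f e * (M ^\<^sub>m e) $$ (i, j))"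

end

theory Submission
  imports Defs
begin

text \<open>Fix a singular value \<open>\<sigma>\<close> in the interval with singular vectors \<open>u\<close> and \<open>v\<close>. The proof bounds the sum of
the squared sines in two independent steps and derives the bound for the Ritz value from it.

The first step is convergence of the iteration. The stacked vector of \<open>v\<close> and \<open>u\<close>, divided
by \<open>sqrt 2\<close>, is an eigenvector of the augmented matrix, hence one of the filter, with eigenvalue \<open>\<gamma> i\<close>.
The initial space contains a vector that agrees with it in all components along the wanted
eigenvectors; the filter damps the remaining components by \<open>\<gamma> p / \<gamma> i\<close> relative to it in each step
(\<open>subspace_iteration_error\<close>). Since the upper and the lower part of the iterate are
orthonormalized separately, the squared distances of \<open>v\<close> and \<open>u\<close> from the two trial spaces
add up to at most \<open>2 (\<gamma> p / \<gamma> i) ^ (2 k) \<parallel>E0\<parallel>\<^sup>2\<close> (\<open>defect_blocks_le\<close>).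

The second step is a Rayleigh-Ritz estimate. Compressing the eigenvalue equation to the trial space leaves a
residual of size at most \<open>\<alpha>\<close> times the distance from the trial space (\<open>projected_residual_bound\<close>). In
the basis of Ritz vectors this residual dominates the components of \<open>v\<close> and \<open>u\<close> along the
Ritz vectors of index \<open>j \<noteq> i\<close>, weighted by the gap between \<open>\<sigma>\<close> and the Ritz value
(\<open>ritz_components_bound\<close>). The squared sines consist of these components and the distance from
the trial space, which gives the factor \<open>1 + \<alpha>\<^sup>2 / \<eta>\<^sup>2\<close> (\<open>sin_sum_le_defect\<close>).

Finally, the Ritz value is the value of the bilinear form of \<open>A\<close> at the pair of Ritz vectors, and this form is
stationary at a pair of singular vectors. The error of the Ritz value is therefore at most
\<open>\<parallel>A\<parallel>\<close> times the sum of the squared sines (\<open>ritz_value_error\<close>), with constant 1.\<close>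

section \<open>Euclidean and spectral norm\<close>

lemma scalar_prod_self_nonneg: "0 \<le> x \<bullet> (x :: real vec)"
  by (auto simp: scalar_prod_def intro!: sum_nonneg)

lemma scalar_prod_self_sum: "x \<bullet> (x :: real vec) = (\<Sum>j<dim_vec x. (x $ j)\<^sup>2)"
  by (simp add: scalar_prod_def power2_eq_square lessThan_atLeast0)

lemma norm2_vec_sq: "(norm2_vec x)\<^sup>2 = x \<bullet> x"
  by (simp add: norm2_vec_def scalar_prod_self_nonneg)

lemma norm2_vec_nonneg: "0 \<le> norm2_vec x"
  by (simp add: norm2_vec_def scalar_prod_self_nonneg)

lemma scalar_prod_self_eq_0:
  assumes "x \<bullet> (x :: real vec) = 0" "x \<in> carrier_vec n"
  shows "x = 0\<^sub>v n"
  using assms by (intro eq_vecI) (auto simp: scalar_prod_self_sum sum_nonneg_eq_0_iff)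

lemma scalar_prod_self_diff:
  fixes x y :: "real vec"
  assumes "x \<in> carrier_vec n" "y \<in> carrier_vec n"
  shows "(x - y) \<bullet> (x - y) = x \<bullet> x - 2 * (x \<bullet> y) + y \<bullet> y"
  using assms
  by (simp add: minus_scalar_prod_distrib[of _ n] scalar_prod_minus_distrib[of _ n]
      comm_scalar_prod[of y n x])

lemma cauchy_schwarz_vec:
  fixes x y :: "real vec"
  assumes x: "x \<in> carrier_vec n" and y: "y \<in> carrier_vec n"
  shows "(x \<bullet> y)\<^sup>2 \<le> (x \<bullet> x) * (y \<bullet> y)"
proof (cases "y \<bullet> y = 0")
  case True
  then have "y = 0\<^sub>v n" using y by (rule scalar_prod_self_eq_0)
  then show ?thesis using x by simp
next
  case False
  then have pos: "y \<bullet> y > 0" using scalar_prod_self_nonneg[of y] by linarith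
  \<comment> \<open>The multiple of \<open>y\<close> that is closest to \<open>x\<close>.\<close>
  define t where "t = (x \<bullet> y) / (y \<bullet> y)"
  have "0 \<le> (x - t \<cdot>\<^sub>v y) \<bullet> (x - t \<cdot>\<^sub>v y)" by (rule scalar_prod_self_nonneg)
  also have "\<dots> = x \<bullet> x - 2 * (x \<bullet> (t \<cdot>\<^sub>v y)) + (t \<cdot>\<^sub>v y) \<bullet> (t \<cdot>\<^sub>v y)"
    using x y by (intro scalar_prod_self_diff) auto
  also have "\<dots> = x \<bullet> x - 2 * t * (x \<bullet> y) + t * t * (y \<bullet> y)"
    using x y by simp
  also have "\<dots> = x \<bullet> x - (x \<bullet> y)\<^sup>2 / (y \<bullet> y)"
    using pos by (simp add: t_def power2_eq_square field_simps)
  finally show ?thesis using pos by (simp add: field_simps)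
qed

text \<open>The supremum that defines the spectral norm is bounded by the Frobenius norm; this is what makes
it an upper bound for each of its members.\<close>

lemma norm2_mat_bdd: "bdd_above ((\<lambda>x. norm2_vec (M *\<^sub>v x)) ` {x \<in> carrier_vec (dim_col M). norm2_vec x \<le> 1})"
proof (rule bdd_aboveI2)
  fix x assume "x \<in> {x \<in> carrier_vec (dim_col M). norm2_vec x \<le> 1}"
  then have x: "x \<in> carrier_vec (dim_col M)" and "norm2_vec x \<le> 1" by auto
  then have le1: "x \<bullet> x \<le> 1" by (simp add: norm2_vec_def)
  have "(M *\<^sub>v x) \<bullet> (M *\<^sub>v x) = (\<Sum>i<dim_row M. (row M i \<bullet> x)\<^sup>2)"
    by (simp add: scalar_prod_self_sum)
  also have "\<dots> \<le> (\<Sum>i<dim_row M. row M i \<bullet> row M i)"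
  proof (rule sum_mono)
    fix i assume "i \<in> {..<dim_row M}"
    have "(row M i \<bullet> x)\<^sup>2 \<le> (row M i \<bullet> row M i) * (x \<bullet> x)"
      using x by (intro cauchy_schwarz_vec) auto
    also have "\<dots> \<le> row M i \<bullet> row M i"
      using mult_left_mono[OF le1 scalar_prod_self_nonneg[of "row M i"]] by simp
    finally show "(row M i \<bullet> x)\<^sup>2 \<le> row M i \<bullet> row M i" .
  qed
  finally show "norm2_vec (M *\<^sub>v x) \<le> sqrt (\<Sum>i<dim_row M. row M i \<bullet> row M i)"
    by (simp add: norm2_vec_def)
qed

lemma norm2_mat_ge_unit:
  assumes "x \<in> carrier_vec (dim_col M)" "x \<bullet> x \<le> 1"
  shows "norm2_vec (M *\<^sub>v x) \<le> norm2_mat M"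
  unfolding norm2_mat_def
  using assms by (intro cSUP_upper norm2_mat_bdd) (auto simp: norm2_vec_def)

lemma norm2_mat_nonneg: "0 \<le> norm2_mat M"
proof -
  have "norm2_vec (M *\<^sub>v 0\<^sub>v (dim_col M)) \<le> norm2_mat M"
    by (rule norm2_mat_ge_unit) auto
  then show ?thesis using norm2_vec_nonneg order_trans by blast
qed

lemma norm2_mat_bound:
  assumes x: "x \<in> carrier_vec (dim_col M)"
  shows "(M *\<^sub>v x) \<bullet> (M *\<^sub>v x) \<le> (norm2_mat M)\<^sup>2 * (x \<bullet> x)"
proof (cases "x \<bullet> x = 0")
  case True
  then have "x = 0\<^sub>v (dim_col M)" using x by (rule scalar_prod_self_eq_0)
  then have "M *\<^sub>v x = 0\<^sub>v (dim_row M)" by (auto simp: scalar_prod_def)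
  then show ?thesis using True by simp
next
  case False
  define s where "s = sqrt (x \<bullet> x)"
  have s: "s > 0" "s * s = x \<bullet> x"
    using False scalar_prod_self_nonneg[of x] by (auto simp: s_def)
  define y where "y = (1 / s) \<cdot>\<^sub>v x"
  have y: "y \<in> carrier_vec (dim_col M)" "y \<bullet> y \<le> 1"
    using s x by (auto simp: y_def)
  have "M *\<^sub>v y = (1 / s) \<cdot>\<^sub>v (M *\<^sub>v x)"
    unfolding y_def using x by (intro mult_mat_vec) auto
  then have eq: "(M *\<^sub>v y) \<bullet> (M *\<^sub>v y) = ((M *\<^sub>v x) \<bullet> (M *\<^sub>v x)) / (x \<bullet> x)"
    using s by (simp add: field_simps)
  have "(M *\<^sub>v y) \<bullet> (M *\<^sub>v y) \<le> (norm2_mat M)\<^sup>2"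
    using power_mono[OF norm2_mat_ge_unit[OF y] norm2_vec_nonneg, of 2] by (simp add: norm2_vec_sq)
  then show ?thesis
    using s False scalar_prod_self_nonneg[of x] unfolding eq by (simp add: field_simps)
qed

lemma norm2_mat_bilinear:
  assumes M: "M \<in> carrier_mat m n" and x: "x \<in> carrier_vec n" and y: "y \<in> carrier_vec m"
  shows "\<bar>y \<bullet> (M *\<^sub>v x)\<bar> \<le> norm2_mat M * (norm2_vec y * norm2_vec x)"
proof -
  have "(y \<bullet> (M *\<^sub>v x))\<^sup>2 \<le> (y \<bullet> y) * ((M *\<^sub>v x) \<bullet> (M *\<^sub>v x))"
    using M x y by (intro cauchy_schwarz_vec) auto
  also have "\<dots> \<le> (y \<bullet> y) * ((norm2_mat M)\<^sup>2 * (x \<bullet> x))"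
    using M x by (intro mult_left_mono norm2_mat_bound scalar_prod_self_nonneg) auto
  also have "\<dots> = (norm2_mat M * (norm2_vec y * norm2_vec x))\<^sup>2"
    by (simp add: power_mult_distrib norm2_vec_sq)
  finally show ?thesis
    by (rule power2_le_imp_le[of "\<bar>y \<bullet> (M *\<^sub>v x)\<bar>", unfolded power2_abs])
       (intro mult_nonneg_nonneg norm2_mat_nonneg norm2_vec_nonneg)
qed

section \<open>Matrices with orthonormal columns\<close>

lemma mult_mat_zero_vec: "B \<in> carrier_mat n p \<Longrightarrow> B *\<^sub>v 0\<^sub>v p = 0\<^sub>v n"
  by (intro eq_vecI) auto


lemma orthonormal_cols_iff:
  assumes "T \<in> carrier_mat n p"
  shows "orthonormal_cols T \<longleftrightarrow>
    (\<forall>i<p. \<forall>j<p. col T i \<bullet> col T j = (if i = j then 1 else 0))"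
proof
  assume "orthonormal_cols T"
  then have eq: "T\<^sup>T * T = 1\<^sub>m p" using assms by (simp add: orthonormal_cols_def)
  show "\<forall>i<p. \<forall>j<p. col T i \<bullet> col T j = (if i = j then 1 else 0)"
  proof (intro allI impI)
    fix i j assume "i < p" "j < p"
    then show "col T i \<bullet> col T j = (if i = j then 1 else 0)"
      using arg_cong[OF eq, of "\<lambda>M. M $$ (i, j)"] assms by simp
  qed
next
  assume "\<forall>i<p. \<forall>j<p. col T i \<bullet> col T j = (if i = j then 1 else 0)"
  then have "T\<^sup>T * T = 1\<^sub>m p" using assms by (intro eq_matI) auto
  then show "orthonormal_cols T" using assms by (simp add: orthonormal_cols_def)
qed

lemma orthonormal_cancel:
  assumes T: "T \<in> carrier_mat n p" "orthonormal_cols T" and z: "z \<in> carrier_vec p"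
  shows "T\<^sup>T *\<^sub>v (T *\<^sub>v z) = z"
proof -
  have "T\<^sup>T *\<^sub>v (T *\<^sub>v z) = (T\<^sup>T * T) *\<^sub>v z"
    using T z by (intro assoc_mult_mat_vec[symmetric]) auto
  also have "\<dots> = 1\<^sub>m p *\<^sub>v z" using T by (simp add: orthonormal_cols_def)
  finally show ?thesis using z by simp
qed

lemma orthonormal_scalar_prod:
  assumes T: "T \<in> carrier_mat n p" "orthonormal_cols T"
    and z: "z \<in> carrier_vec p" and w: "w \<in> carrier_vec p"
  shows "(T *\<^sub>v z) \<bullet> (T *\<^sub>v w) = z \<bullet> w"
proof -
  have "(T *\<^sub>v z) \<bullet> (T *\<^sub>v w) = (T\<^sup>T *\<^sub>v (T *\<^sub>v z)) \<bullet> w"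
    using T z w by (intro transpose_vec_mult_scalar[symmetric]) auto
  then show ?thesis using orthonormal_cancel[OF T z] by simp
qed

lemma orthonormal_square_transpose:
  assumes T: "T \<in> carrier_mat n n" "orthonormal_cols T"
  shows "T * T\<^sup>T = 1\<^sub>m n"
  using T by (intro mat_mult_left_right_inverse[of "T\<^sup>T" n T]) (auto simp: orthonormal_cols_def)

lemma parseval:
  assumes T: "T \<in> carrier_mat n n" "orthonormal_cols T" and x: "x \<in> carrier_vec n"
  shows "(\<Sum>j<n. (col T j \<bullet> x)\<^sup>2) = x \<bullet> x"
proof -
  have "orthonormal_cols (T\<^sup>T)"
    using orthonormal_square_transpose[OF T] T by (simp add: orthonormal_cols_def)
  then have "(T\<^sup>T *\<^sub>v x) \<bullet> (T\<^sup>T *\<^sub>v x) = x \<bullet> x"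
    using T x by (intro orthonormal_scalar_prod) auto
  then show ?thesis using T by (simp add: scalar_prod_self_sum)
qed

text \<open>For \<open>T\<close> with orthonormal columns this is the squared distance of \<open>x\<close> from the column space of
\<open>T\<close>. In this form it depends on \<open>T\<close> only through the coordinates \<open>T\<^sup>T x\<close>, which makes
changes of basis and splittings into blocks immediate.\<close>

definition defect :: "real mat \<Rightarrow> real vec \<Rightarrow> real" where
  "defect T x = x \<bullet> x - (T\<^sup>T *\<^sub>v x) \<bullet> (T\<^sup>T *\<^sub>v x)"

lemma defect_sum:
  assumes "T \<in> carrier_mat n p"
  shows "defect T x = x \<bullet> x - (\<Sum>j<p. (col T j \<bullet> x)\<^sup>2)"
  using assms by (simp add: defect_def scalar_prod_self_sum[of "T\<^sup>T *\<^sub>v x"])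

text \<open>Pythagoras: the residual of the orthogonal projection is orthogonal to the column space, so the
rest of the distance is measured by coordinates.\<close>

lemma dist_sq_range:
  assumes T: "T \<in> carrier_mat n p" "orthonormal_cols T"
    and x: "x \<in> carrier_vec n" and z: "z \<in> carrier_vec p"
  shows "(x - T *\<^sub>v z) \<bullet> (x - T *\<^sub>v z) = defect T x + (T\<^sup>T *\<^sub>v x - z) \<bullet> (T\<^sup>T *\<^sub>v x - z)"
proof -
  have 1: "(x - T *\<^sub>v z) \<bullet> (x - T *\<^sub>v z) = x \<bullet> x - 2 * (x \<bullet> (T *\<^sub>v z)) + z \<bullet> z"
    using T x z by (simp add: scalar_prod_self_diff[of _ n] orthonormal_scalar_prod[OF T])
  have 2: "x \<bullet> (T *\<^sub>v z) = (T\<^sup>T *\<^sub>v x) \<bullet> z"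
    using T x z by (intro transpose_vec_mult_scalar[symmetric]) auto
  show ?thesis using T x z unfolding 1 2 defect_def
    by (subst scalar_prod_self_diff[of _ p]) auto
qed

lemma defect_le:
  assumes T: "T \<in> carrier_mat n p" "orthonormal_cols T"
    and x: "x \<in> carrier_vec n" and z: "z \<in> carrier_vec p"
  shows "defect T x \<le> (x - T *\<^sub>v z) \<bullet> (x - T *\<^sub>v z)"
  using dist_sq_range[OF assms] scalar_prod_self_nonneg by simp

lemma defect_eq:
  assumes T: "T \<in> carrier_mat n p" "orthonormal_cols T" and x: "x \<in> carrier_vec n"
  shows "(x - T *\<^sub>v (T\<^sup>T *\<^sub>v x)) \<bullet> (x - T *\<^sub>v (T\<^sup>T *\<^sub>v x)) = defect T x"
  using dist_sq_range[OF assms, of "T\<^sup>T *\<^sub>v x"] T x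
    minus_cancel_vec[of "T\<^sup>T *\<^sub>v x" p] by simp

lemma orthonormal_mult:
  assumes T: "T \<in> carrier_mat n p" "orthonormal_cols T"
    and W: "W \<in> carrier_mat p r" "orthonormal_cols W"
  shows "orthonormal_cols (T * W)"
proof -
  have "(T * W)\<^sup>T * (T * W) = W\<^sup>T * (T\<^sup>T * (T * W))"
    using T W by (simp add: transpose_mult[OF T(1) W(1)] assoc_mult_mat[of _ r p _ n _ r])
  also have "T\<^sup>T * (T * W) = T\<^sup>T * T * W"
    using T W by (intro assoc_mult_mat[symmetric]) auto
  also have "\<dots> = W" using T W by (simp add: orthonormal_cols_def)
  finally show ?thesis using T W by (simp add: orthonormal_cols_def)
qed

lemma defect_mult_orthogonal:
  assumes T: "T \<in> carrier_mat n p"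
    and W: "W \<in> carrier_mat p p" "orthonormal_cols W" and x: "x \<in> carrier_vec n"
  shows "defect (T * W) x = defect T x"
proof -
  have "orthonormal_cols (W\<^sup>T)"
    using orthonormal_square_transpose[OF W] W by (simp add: orthonormal_cols_def)
  moreover have "(T * W)\<^sup>T *\<^sub>v x = W\<^sup>T *\<^sub>v (T\<^sup>T *\<^sub>v x)"
    using T W x by (simp add: transpose_mult[OF T W(1)])
  ultimately show ?thesis unfolding defect_def
    using T W x by (simp add: orthonormal_scalar_prod[of "W\<^sup>T" p p])
qed

lemma col_span_eq: "col_span M = {M *\<^sub>v z | z. z \<in> carrier_vec (dim_col M)}"
proof -
  have "M *\<^sub>v z \<in> carrier_vec (dim_row M)" for z by (rule carrier_vecI) simp
  moreover have "M \<in> carrier_mat (dim_row M) (dim_col M)" by simp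
  ultimately show ?thesis
    unfolding col_span_def vec_space.col_space_eq[OF \<open>M \<in> carrier_mat (dim_row M) (dim_col M)\<close>]
    by blast
qed

text \<open>The Ritz vectors arise from the computed bases by an orthogonal change of basis, so they span the
same space and share its orthogonal projector.\<close>

lemma col_span_mult_orthogonal:
  assumes T: "T \<in> carrier_mat n p" and W: "W \<in> carrier_mat p p" "orthonormal_cols W"
  shows "col_span (T * W) = col_span T"
proof -
  have "W * W\<^sup>T = 1\<^sub>m p" using W by (rule orthonormal_square_transpose)
  then have cancel: "T *\<^sub>v z = (T * W) *\<^sub>v (W\<^sup>T *\<^sub>v z)" if "z \<in> carrier_vec p" for z :: "real vec"
  proof -
    have "(T * W) *\<^sub>v (W\<^sup>T *\<^sub>v z) = T *\<^sub>v (W *\<^sub>v (W\<^sup>T *\<^sub>v z))"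
      using T W that by (intro assoc_mult_mat_vec) auto
    also have "W *\<^sub>v (W\<^sup>T *\<^sub>v z) = (W * W\<^sup>T) *\<^sub>v z"
      using W that by (intro assoc_mult_mat_vec[symmetric]) auto
    finally show ?thesis using that \<open>W * W\<^sup>T = 1\<^sub>m p\<close> by simp
  qed
  show ?thesis
  proof
    show "col_span (T * W) \<subseteq> col_span T"
      unfolding col_span_eq
    proof clarsimp
      fix z :: "real vec" assume "z \<in> carrier_vec (dim_col W)"
      then have "(T * W) *\<^sub>v z = T *\<^sub>v (W *\<^sub>v z)" "W *\<^sub>v z \<in> carrier_vec (dim_col T)"
        using T W by (auto intro!: assoc_mult_mat_vec)
      then show "\<exists>za. T * W *\<^sub>v z = T *\<^sub>v za \<and> za \<in> carrier_vec (dim_col T)" by blast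
    qed
    show "col_span T \<subseteq> col_span (T * W)"
      unfolding col_span_eq
    proof clarsimp
      fix z :: "real vec" assume "z \<in> carrier_vec (dim_col T)"
      then have "T *\<^sub>v z = (T * W) *\<^sub>v (W\<^sup>T *\<^sub>v z)" "W\<^sup>T *\<^sub>v z \<in> carrier_vec (dim_col W)"
        using T W cancel by auto
      then show "\<exists>za. T *\<^sub>v z = T * W *\<^sub>v za \<and> za \<in> carrier_vec (dim_col W)" by blast
    qed
  qed
qed

text \<open>The difference of \<open>B\<^sup>T x\<close> and the coordinates of the projection of \<open>x\<close> is the coordinate
vector of an element of the span that is orthogonal to the whole span, itself included.\<close>

lemma orthogonal_projector_eq:
  assumes B: "B \<in> carrier_mat N K" "orthonormal_cols B"
    and Pk: "is_orthogonal_projector N Pk (col_span B)" and x: "x \<in> carrier_vec N"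
  shows "Pk *\<^sub>v x = B *\<^sub>v (B\<^sup>T *\<^sub>v x)"
proof -
  have "Pk *\<^sub>v x \<in> col_span B" and orth: "\<And>w. w \<in> col_span B \<Longrightarrow> (x - Pk *\<^sub>v x) \<bullet> w = 0"
    using Pk x by (auto simp: is_orthogonal_projector_def)
  then obtain z where z: "z \<in> carrier_vec K" "Pk *\<^sub>v x = B *\<^sub>v z"
    using B by (auto simp: col_span_eq)
  define w where "w = B\<^sup>T *\<^sub>v x - z"
  have w: "w \<in> carrier_vec K" using B z x by (auto simp: w_def)
  have "0 = (x - B *\<^sub>v z) \<bullet> (B *\<^sub>v w)"
    using orth[of "B *\<^sub>v w"] B z w by (auto simp: col_span_eq)
  also have "\<dots> = (B\<^sup>T *\<^sub>v (x - B *\<^sub>v z)) \<bullet> w"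
    using B x z w by (intro transpose_vec_mult_scalar[symmetric]) auto
  also have "B\<^sup>T *\<^sub>v (x - B *\<^sub>v z) = w"
    unfolding w_def using B x z
    by (simp add: mult_minus_distrib_mat_vec[of _ K N] orthonormal_cancel[OF B])
  finally have "w = 0\<^sub>v K" using w by (intro scalar_prod_self_eq_0) auto
  then have w0: "B\<^sup>T *\<^sub>v x - z = 0\<^sub>v K" by (simp add: w_def)
  have "B\<^sup>T *\<^sub>v x = z"
  proof (rule eq_vecI)
    fix i assume "i < dim_vec z"
    then show "(B\<^sup>T *\<^sub>v x) $ i = z $ i"
      using arg_cong[OF w0, of "\<lambda>v. v $ i"] z by simp
  qed (use B z in simp)
  then show ?thesis using z by simp
qed

text \<open>The basic inequality of the Rayleigh-Ritz method. Put \<open>e = x - P x\<close>. Applying \<open>P\<close> to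
\<open>S x = \<sigma> x\<close> shows that \<open>P S e = \<sigma> P x - P S P x\<close>, and \<open>e = (I - P) e\<close>, so \<open>P S e\<close> is the
value at \<open>e\<close> of the off-diagonal block \<open>P S (I - P)\<close>. The vector \<open>r\<close> holds the coordinates
of \<open>P S e\<close>: it measures how far the projection of \<open>x\<close> is from being an eigenvector of the
compression of \<open>S\<close> for the value \<open>\<sigma>\<close>.\<close>

lemma projected_residual_bound:
  assumes B: "B \<in> carrier_mat N K" "orthonormal_cols B"
    and Pk: "is_orthogonal_projector N Pk (col_span B)"
    and S: "S \<in> carrier_mat N N" and x: "x \<in> carrier_vec N" and eig: "S *\<^sub>v x = \<sigma> \<cdot>\<^sub>v x"
    and y: "y = B\<^sup>T *\<^sub>v x"
    and r: "r = \<sigma> \<cdot>\<^sub>v y - B\<^sup>T *\<^sub>v (S *\<^sub>v (B *\<^sub>v y))"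
  shows "r \<bullet> r \<le> (norm2_mat (Pk * S * (1\<^sub>m N - Pk)))\<^sup>2 * defect B x"
proof -
  define e where "e = x - B *\<^sub>v y"
  have yc: "y \<in> carrier_vec K" using B x by (simp add: y)
  have ec: "e \<in> carrier_vec N" using B x yc by (auto simp: e_def)
  have Pc: "Pk \<in> carrier_mat N N" using Pk by (simp add: is_orthogonal_projector_def)
  have "B\<^sup>T *\<^sub>v e = 0\<^sub>v K"
    unfolding e_def using B x yc
    by (simp add: mult_minus_distrib_mat_vec[of _ K N] orthonormal_cancel[OF B] y[symmetric])
  then have "Pk *\<^sub>v e = 0\<^sub>v N"
    using orthogonal_projector_eq[OF B Pk ec] mult_mat_zero_vec[OF B(1)] by simp
  then have 1: "(1\<^sub>m N - Pk) *\<^sub>v e = e"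
    using ec Pc by (simp add: minus_mult_distrib_mat_vec[of _ N N])
  have "(Pk * S * (1\<^sub>m N - Pk)) *\<^sub>v e = Pk *\<^sub>v (S *\<^sub>v e)"
  proof -
    have "(Pk * S * (1\<^sub>m N - Pk)) *\<^sub>v e = (Pk * S) *\<^sub>v ((1\<^sub>m N - Pk) *\<^sub>v e)"
      using ec Pc S by (intro assoc_mult_mat_vec[of _ N N _ N]) auto
    also have "\<dots> = Pk *\<^sub>v (S *\<^sub>v e)"
      unfolding 1 using ec Pc S by (intro assoc_mult_mat_vec[of _ N N _ N])
    finally show ?thesis .
  qed
  also have "\<dots> = B *\<^sub>v (B\<^sup>T *\<^sub>v (S *\<^sub>v e))"
    using S ec by (intro orthogonal_projector_eq[OF B Pk]) auto
  also have "B\<^sup>T *\<^sub>v (S *\<^sub>v e) = r"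
  proof -
    have "S *\<^sub>v e = \<sigma> \<cdot>\<^sub>v x - S *\<^sub>v (B *\<^sub>v y)"
      unfolding e_def using S B x yc by (simp add: mult_minus_distrib_mat_vec[of _ N N] eig)
    moreover have "B\<^sup>T *\<^sub>v (\<sigma> \<cdot>\<^sub>v x - S *\<^sub>v (B *\<^sub>v y)) = \<sigma> \<cdot>\<^sub>v y - B\<^sup>T *\<^sub>v (S *\<^sub>v (B *\<^sub>v y))"
      using S B x yc by (simp add: mult_minus_distrib_mat_vec[of _ K N] mult_mat_vec[of _ K N] y)
    ultimately show ?thesis by (simp add: r)
  qed
  finally have eq: "(Pk * S * (1\<^sub>m N - Pk)) *\<^sub>v e = B *\<^sub>v r" .
  have rc: "r \<in> carrier_vec K" using B S yc by (auto simp: r)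
  have "r \<bullet> r = (B *\<^sub>v r) \<bullet> (B *\<^sub>v r)" using B rc by (simp add: orthonormal_scalar_prod)
  also have "\<dots> \<le> (norm2_mat (Pk * S * (1\<^sub>m N - Pk)))\<^sup>2 * (e \<bullet> e)"
    unfolding eq[symmetric] using ec Pc by (intro norm2_mat_bound) auto
  also have "e \<bullet> e = defect B x" unfolding e_def y by (rule defect_eq[OF B x])
  finally show ?thesis .
qed

section \<open>Block matrices\<close>

lemma mult3_mat_vec:
  assumes A: "(A :: real mat) \<in> carrier_mat m k" and B: "B \<in> carrier_mat k l" and C: "C \<in> carrier_mat l n"
    and x: "x \<in> carrier_vec n"
  shows "(A * B * C) *\<^sub>v x = A *\<^sub>v (B *\<^sub>v (C *\<^sub>v x))"
proof -
  have "(A * B * C) *\<^sub>v x = (A * B) *\<^sub>v (C *\<^sub>v x)"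
    using A B C x by (intro assoc_mult_mat_vec) auto
  also have "\<dots> = A *\<^sub>v (B *\<^sub>v (C *\<^sub>v x))"
    using A B C x by (intro assoc_mult_mat_vec) auto
  finally show ?thesis .
qed

lemma transpose_mult3:
  assumes A: "(A :: real mat) \<in> carrier_mat m k" and B: "B \<in> carrier_mat k l" and C: "C \<in> carrier_mat l n"
  shows "(A * B * C)\<^sup>T = C\<^sup>T * B\<^sup>T * A\<^sup>T"
proof -
  have "(A * B * C)\<^sup>T = C\<^sup>T * (A * B)\<^sup>T"
    using A B C by (intro transpose_mult) auto
  also have "\<dots> = C\<^sup>T * (B\<^sup>T * A\<^sup>T)" using A B by (simp add: transpose_mult)
  also have "\<dots> = C\<^sup>T * B\<^sup>T * A\<^sup>T"
    using A B C by (intro assoc_mult_mat[symmetric]) auto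
  finally show ?thesis .
qed

lemma block_diag2_carrier:
  assumes "M \<in> carrier_mat n1 p1" "N \<in> carrier_mat n2 p2"
  shows "block_diag2 M N \<in> carrier_mat (n1 + n2) (p1 + p2)"
  using assms by (auto simp: block_diag2_def)

lemma block_diag2_mult_vec:
  assumes M: "M \<in> carrier_mat n1 p1" and N: "N \<in> carrier_mat n2 p2"
    and a: "a \<in> carrier_vec p1" and b: "b \<in> carrier_vec p2"
  shows "block_diag2 M N *\<^sub>v (a @\<^sub>v b) = (M *\<^sub>v a) @\<^sub>v (N *\<^sub>v b)"
proof -
  have z1: "0\<^sub>m n1 p2 *\<^sub>v b = 0\<^sub>v n1" and z2: "0\<^sub>m n2 p1 *\<^sub>v a = 0\<^sub>v n2"
    using a b by (auto intro!: eq_vecI)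
  show ?thesis
    unfolding block_diag2_def carrier_matD[OF M] carrier_matD[OF N]
    by (subst four_block_mat_mult_vec[OF M _ _ N a b]) (use M N a b z1 z2 in auto)
qed

lemma block_diag2_transpose: "(block_diag2 M N)\<^sup>T = block_diag2 (M\<^sup>T) (N\<^sup>T)"
  unfolding block_diag2_def
  by (subst transpose_four_block_mat[of M "dim_row M" "dim_col M" _ "dim_col N" _ "dim_row N"])
    (auto simp: zero_transpose_mat)

lemma block_diag2_mult:
  assumes "M \<in> carrier_mat n1 p1" "N \<in> carrier_mat n2 p2"
    "M' \<in> carrier_mat p1 q1" "N' \<in> carrier_mat p2 q2"
  shows "block_diag2 M N * block_diag2 M' N' = block_diag2 (M * M') (N * N')"
proof -
  have "block_diag2 M N * block_diag2 M' N' =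
    four_block_mat (M * M' + 0\<^sub>m n1 p2 * 0\<^sub>m p2 q1) (M * 0\<^sub>m p1 q2 + 0\<^sub>m n1 p2 * N')
      (0\<^sub>m n2 p1 * M' + N * 0\<^sub>m p2 q1) (0\<^sub>m n2 p1 * 0\<^sub>m p1 q2 + N * N')"
    using assms unfolding block_diag2_def
    by (simp, subst mult_four_block_mat[of M n1 p1 _ p2 _ n2 N M' q1 _ q2]) auto
  also have "\<dots> = block_diag2 (M * M') (N * N')"
    using assms by (simp add: block_diag2_def)
  finally show ?thesis .
qed

lemma block_diag2_orthonormal:
  assumes "M \<in> carrier_mat n1 p1" "N \<in> carrier_mat n2 p2" "orthonormal_cols M" "orthonormal_cols N"
  shows "orthonormal_cols (block_diag2 M N)"
proof -
  have "(block_diag2 M N)\<^sup>T * block_diag2 M N = block_diag2 (M\<^sup>T * M) (N\<^sup>T * N)"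
    unfolding block_diag2_transpose
    using assms by (intro block_diag2_mult[of _ p1 n1 _ p2 n2]) auto
  also have "\<dots> = block_diag2 (1\<^sub>m p1) (1\<^sub>m p2)" using assms by (simp add: orthonormal_cols_def)
  also have "\<dots> = 1\<^sub>m (p1 + p2)" by (simp add: block_diag2_def)
  finally show ?thesis using block_diag2_carrier[OF assms(1,2)] by (simp add: orthonormal_cols_def)
qed

lemma aug_mat_carrier: "A \<in> carrier_mat m n \<Longrightarrow> aug_mat A \<in> carrier_mat (n + m) (n + m)"
  by (auto simp: aug_mat_def)

lemma aug_mat_mult_vec:
  assumes A: "A \<in> carrier_mat m n" and v: "v \<in> carrier_vec n" and u: "u \<in> carrier_vec m"
  shows "aug_mat A *\<^sub>v (v @\<^sub>v u) = (A\<^sup>T *\<^sub>v u) @\<^sub>v (A *\<^sub>v v)"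
proof -
  have z1: "0\<^sub>m n n *\<^sub>v v = 0\<^sub>v n" and z2: "0\<^sub>m m m *\<^sub>v u = 0\<^sub>v m"
    using u v by (auto intro!: eq_vecI)
  have At: "A\<^sup>T \<in> carrier_mat n m" using A by simp
  show ?thesis
    unfolding aug_mat_def carrier_matD[OF A]
    by (subst four_block_mat_mult_vec[OF _ At A _ v u]) (use A u v z1 z2 in auto)
qed

lemma append_vec_minus:
  assumes "a \<in> carrier_vec n" "a' \<in> carrier_vec n" "b \<in> carrier_vec m" "b' \<in> carrier_vec m"
  shows "(a @\<^sub>v b) - (a' @\<^sub>v b') = (a - a') @\<^sub>v (b - (b' :: real vec))"
  using assms by (intro eq_vecI) auto

lemma append_vec_smult: "c \<cdot>\<^sub>v (a @\<^sub>v b) = (c \<cdot>\<^sub>v a) @\<^sub>v (c \<cdot>\<^sub>v b)"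
  by (intro eq_vecI) auto

lemma scalar_prod_append_self: "(a @\<^sub>v b) \<bullet> (a @\<^sub>v b) = a \<bullet> a + b \<bullet> (b :: real vec)"
  by (rule scalar_prod_append[of _ "dim_vec a" _ "dim_vec b"]) (auto intro: carrier_vecI)

lemma mult_diagonal_mat_vec:
  assumes D: "D \<in> carrier_mat p p" "diagonal_mat (D :: real mat)" and a: "a \<in> carrier_vec p" and j: "j < p"
  shows "(D *\<^sub>v a) $ j = D $$ (j, j) * a $ j"
proof -
  have "(D *\<^sub>v a) $ j = (\<Sum>i<p. D $$ (j, i) * a $ i)"
    using D a j by (simp add: scalar_prod_def lessThan_atLeast0)
  also have "\<dots> = (\<Sum>i<p. if i = j then D $$ (j, j) * a $ j else 0)"
    using D j by (intro sum.cong) (auto simp: diagonal_mat_def)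
  finally show ?thesis using j by simp
qed

section \<open>Errors of Ritz values and Ritz vectors\<close>

text \<open>In the basis of Ritz vectors the compression of the augmented matrix splits into the
blocks \<open>[[0, s j], [s j, 0]]\<close>, one for each Ritz value \<open>s j\<close>. If \<open>a\<close> and \<open>b\<close> are the
coordinates of \<open>v\<close> and \<open>u\<close> for index \<open>j\<close>, the residual has there the entries
\<open>\<sigma> a - s j b\<close> and \<open>\<sigma> b - s j a\<close>. Their squares sum up to
\<open>(\<sigma> - s j)\<^sup>2 (a\<^sup>2 + b\<^sup>2) + 2 \<sigma> (s j) (a - b)\<^sup>2\<close>, and the last term is not negative. The
eigenvalue \<open>- s j\<close> of the block is thus harmless.\<close>

lemma ritz_components_bound:
  fixes s :: "nat \<Rightarrow> real"
  assumes A: "A \<in> carrier_mat m n"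
    and T1: "T1 \<in> carrier_mat n p" "orthonormal_cols T1"
    and T2: "T2 \<in> carrier_mat m p" "orthonormal_cols T2"
    and D: "T2\<^sup>T * A * T1 = D" "diagonal_mat D"
    and s: "\<And>j. j < p \<Longrightarrow> D $$ (j, j) = s j \<and> 0 \<le> s j"
    and Pk: "is_orthogonal_projector (n + m) Pk (col_span (block_diag2 T1 T2))"
    and u: "u \<in> carrier_vec m" and v: "v \<in> carrier_vec n"
    and Av: "A *\<^sub>v v = \<sigma> \<cdot>\<^sub>v u" and Au: "A\<^sup>T *\<^sub>v u = \<sigma> \<cdot>\<^sub>v v" and \<sigma>: "0 \<le> \<sigma>"
  shows "(\<Sum>j<p. (\<sigma> - s j)\<^sup>2 * ((col T1 j \<bullet> v)\<^sup>2 + (col T2 j \<bullet> u)\<^sup>2))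
    \<le> (norm2_mat (Pk * aug_mat A * (1\<^sub>m (n + m) - Pk)))\<^sup>2 * (defect T1 v + defect T2 u)"
proof -
  let ?B = "block_diag2 T1 T2"
  define x where "x = v @\<^sub>v u"
  define a where "a = T1\<^sup>T *\<^sub>v v"
  define b where "b = T2\<^sup>T *\<^sub>v u"
  have ac: "a \<in> carrier_vec p" and bc: "b \<in> carrier_vec p"
    using T1 T2 u v by (auto simp: a_def b_def)
  have Dc: "D \<in> carrier_mat p p" using D(1) T1 T2 A by auto
  have B: "?B \<in> carrier_mat (n + m) (p + p)" "orthonormal_cols ?B"
    using T1 T2 by (auto intro: block_diag2_carrier block_diag2_orthonormal)
  have y: "?B\<^sup>T *\<^sub>v x = a @\<^sub>v b"
    unfolding x_def a_def b_def block_diag2_transpose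
    using T1 T2 u v by (intro block_diag2_mult_vec) auto
  have By: "?B *\<^sub>v (a @\<^sub>v b) = (T1 *\<^sub>v a) @\<^sub>v (T2 *\<^sub>v b)"
    using T1(1) T2(1) ac bc by (rule block_diag2_mult_vec)
  have SBy: "aug_mat A *\<^sub>v ((T1 *\<^sub>v a) @\<^sub>v (T2 *\<^sub>v b)) = (A\<^sup>T *\<^sub>v (T2 *\<^sub>v b)) @\<^sub>v (A *\<^sub>v (T1 *\<^sub>v a))"
    using A T1 T2 ac bc by (intro aug_mat_mult_vec) auto
  have BSBy: "?B\<^sup>T *\<^sub>v ((A\<^sup>T *\<^sub>v (T2 *\<^sub>v b)) @\<^sub>v (A *\<^sub>v (T1 *\<^sub>v a)))
      = (T1\<^sup>T *\<^sub>v (A\<^sup>T *\<^sub>v (T2 *\<^sub>v b))) @\<^sub>v (T2\<^sup>T *\<^sub>v (A *\<^sub>v (T1 *\<^sub>v a)))"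
    unfolding block_diag2_transpose
    using A T1 T2 ac bc by (intro block_diag2_mult_vec[of _ p n _ p m]) auto
  have Da: "T2\<^sup>T *\<^sub>v (A *\<^sub>v (T1 *\<^sub>v a)) = D *\<^sub>v a"
    unfolding D(1)[symmetric] using T2 A T1 ac
    by (intro mult3_mat_vec[symmetric, of _ p m _ n _ p]) auto
  have "D\<^sup>T = T1\<^sup>T * A\<^sup>T * T2"
    unfolding D(1)[symmetric] using T2 A T1 by (subst transpose_mult3[of _ p m _ n _ p]) auto
  then have Db: "T1\<^sup>T *\<^sub>v (A\<^sup>T *\<^sub>v (T2 *\<^sub>v b)) = D\<^sup>T *\<^sub>v b"
    using T2 A T1 bc mult3_mat_vec[of "T1\<^sup>T" p n "A\<^sup>T" m T2 p b] by simp
  define ra where "ra = \<sigma> \<cdot>\<^sub>v a - D\<^sup>T *\<^sub>v b"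
  define rb where "rb = \<sigma> \<cdot>\<^sub>v b - D *\<^sub>v a"
  have DbC: "D\<^sup>T *\<^sub>v b \<in> carrier_vec p" and DaC: "D *\<^sub>v a \<in> carrier_vec p"
    using Dc ac bc by auto
  have r: "ra @\<^sub>v rb = \<sigma> \<cdot>\<^sub>v (a @\<^sub>v b) - ?B\<^sup>T *\<^sub>v (aug_mat A *\<^sub>v (?B *\<^sub>v (a @\<^sub>v b)))"
    unfolding By SBy BSBy Da Db ra_def rb_def append_vec_smult
    using ac bc DbC DaC by (intro append_vec_minus[symmetric]) auto
  have eig: "aug_mat A *\<^sub>v x = \<sigma> \<cdot>\<^sub>v x"
    unfolding x_def aug_mat_mult_vec[OF A v u] Av Au append_vec_smult ..
  have xc: "x \<in> carrier_vec (n + m)" using u v by (simp add: x_def)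
  have main: "(ra @\<^sub>v rb) \<bullet> (ra @\<^sub>v rb)
      \<le> (norm2_mat (Pk * aug_mat A * (1\<^sub>m (n + m) - Pk)))\<^sup>2 * defect ?B x"
    by (rule projected_residual_bound[OF B Pk aug_mat_carrier[OF A] xc eig y[symmetric] r])
  have def: "defect ?B x = defect T1 v + defect T2 u"
    unfolding defect_def y
    by (simp add: x_def scalar_prod_append_self a_def[symmetric] b_def[symmetric])
  have raj: "ra $ j = \<sigma> * a $ j - s j * b $ j" if "j < p" for j
    unfolding ra_def using that ac bc Dc s[OF that] mult_diagonal_mat_vec[of "D\<^sup>T" p b j] D(2) DbC
    by (simp add: diagonal_mat_def del: index_mult_mat_vec)
  have rbj: "rb $ j = \<sigma> * b $ j - s j * a $ j" if "j < p" for j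
    unfolding rb_def using that ac bc Dc s[OF that] mult_diagonal_mat_vec[of "D" p a j] D(2) DaC
    by (simp del: index_mult_mat_vec)
  have "(\<Sum>j<p. (\<sigma> - s j)\<^sup>2 * ((col T1 j \<bullet> v)\<^sup>2 + (col T2 j \<bullet> u)\<^sup>2))
      \<le> (\<Sum>j<p. (ra $ j)\<^sup>2 + (rb $ j)\<^sup>2)"
  proof (rule sum_mono)
    fix j assume "j \<in> {..<p}"
    then have j: "j < p" by simp
    have aj: "a $ j = col T1 j \<bullet> v" and bj: "b $ j = col T2 j \<bullet> u"
      using j T1 T2 by (auto simp: a_def b_def)
    have "0 \<le> 2 * \<sigma> * s j * (a $ j - b $ j)\<^sup>2" using \<sigma> s[OF j] by simp
    then have "(\<sigma> - s j)\<^sup>2 * ((a $ j)\<^sup>2 + (b $ j)\<^sup>2) \<le> (ra $ j)\<^sup>2 + (rb $ j)\<^sup>2"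
      unfolding raj[OF j] rbj[OF j] by (simp add: power2_eq_square algebra_simps)
    then show "(\<sigma> - s j)\<^sup>2 * ((col T1 j \<bullet> v)\<^sup>2 + (col T2 j \<bullet> u)\<^sup>2) \<le> (ra $ j)\<^sup>2 + (rb $ j)\<^sup>2"
      unfolding aj bj .
  qed
  also have "\<dots> = (ra @\<^sub>v rb) \<bullet> (ra @\<^sub>v rb)"
    unfolding scalar_prod_append_self scalar_prod_self_sum[of ra] scalar_prod_self_sum[of rb]
    using carrier_vecD[OF DbC] carrier_vecD[OF DaC] by (simp only: ra_def rb_def sum.distrib index_minus_vec)
  finally show ?thesis using main unfolding def by linarith
qed

lemma sin_sq_acute_angle:
  assumes x: "x \<in> carrier_vec n" "x \<bullet> x = 1" and y: "y \<in> carrier_vec n" "y \<bullet> y = 1"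
  shows "(sin (acute_angle x y))\<^sup>2 = 1 - (x \<bullet> y)\<^sup>2"
proof -
  have "(x \<bullet> y)\<^sup>2 \<le> 1" using cauchy_schwarz_vec[OF x(1) y(1)] x y by simp
  then have "\<bar>x \<bullet> y\<bar> \<le> 1" by (simp add: abs_square_le_1)
  then show ?thesis
    using x y by (simp add: acute_angle_def norm2_vec_def sin_squared_eq)
qed

text \<open>The squared sines of the two angles leave out exactly the two coordinates of index \<open>i\<close>. What
remains is the part outside the trial space, which is the defect, and the coordinates of the
other indices, where the separation \<open>\<eta>\<close> permits to divide the residual bound. The
eigenvalue \<open>- s i\<close> of the compression belongs to index \<open>i\<close> and never has to be separated
from \<open>\<sigma>\<close>; this is why the two angles are treated jointly, and not the angle between the stacked
vectors.\<close>

lemma sin_sum_le_defect: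
  fixes s :: "nat \<Rightarrow> real"
  assumes T1: "T1 \<in> carrier_mat n p" and T2: "T2 \<in> carrier_mat m p"
    and u: "u \<bullet> u = 1" and v: "v \<bullet> v = 1" and i: "i < p"
    and comp: "(\<Sum>j<p. (\<sigma> - s j)\<^sup>2 * ((col T1 j \<bullet> v)\<^sup>2 + (col T2 j \<bullet> u)\<^sup>2))
      \<le> \<alpha>\<^sup>2 * (defect T1 v + defect T2 u)"
    and sep: "\<And>j. j < p \<Longrightarrow> j \<noteq> i \<Longrightarrow> \<eta>\<^sup>2 \<le> (\<sigma> - s j)\<^sup>2" and \<eta>: "\<eta> \<noteq> (0 :: real)"
  shows "(1 - (col T2 i \<bullet> u)\<^sup>2) + (1 - (col T1 i \<bullet> v)\<^sup>2)
    \<le> (1 + \<alpha>\<^sup>2 / \<eta>\<^sup>2) * (defect T1 v + defect T2 u)"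
proof -
  let ?w = "\<lambda>j. (col T1 j \<bullet> v)\<^sup>2 + (col T2 j \<bullet> u)\<^sup>2"
  let ?d = "defect T1 v + defect T2 u"
  have d: "?d = 2 - (\<Sum>j<p. ?w j)"
    using defect_sum[OF T1, of v] defect_sum[OF T2, of u] u v by (simp add: sum.distrib)
  have split: "(\<Sum>j<p. ?w j) = ?w i + (\<Sum>j\<in>{..<p} - {i}. ?w j)"
    using i by (simp add: sum.remove[of _ i])
  have "\<eta>\<^sup>2 * (\<Sum>j\<in>{..<p} - {i}. ?w j) = (\<Sum>j\<in>{..<p} - {i}. \<eta>\<^sup>2 * ?w j)"
    by (rule sum_distrib_left)
  also have "\<dots> \<le> (\<Sum>j\<in>{..<p} - {i}. (\<sigma> - s j)\<^sup>2 * ?w j)"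
    using sep by (intro sum_mono mult_right_mono) auto
  also have "\<dots> \<le> (\<Sum>j<p. (\<sigma> - s j)\<^sup>2 * ?w j)"
    by (intro sum_mono2) auto
  finally have "\<eta>\<^sup>2 * (\<Sum>j\<in>{..<p} - {i}. ?w j) \<le> \<alpha>\<^sup>2 * ?d" using comp by linarith
  then have "(\<Sum>j\<in>{..<p} - {i}. ?w j) \<le> \<alpha>\<^sup>2 / \<eta>\<^sup>2 * ?d"
    using \<eta> by (simp add: field_simps)
  then show ?thesis using d split unfolding distrib_right mult_1_left by linarith
qed

text \<open>Here \<open>x\<close> and \<open>y\<close> are, up to sign, the cosines of acute angles \<open>\<theta>\<close> and \<open>\<theta>'\<close>, and the right hand side is
\<open>N (sin\<^sup>2 \<theta> + sin\<^sup>2 \<theta>')\<close>. The crucial estimate is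
\<open>1 - cos (\<theta> + \<theta>') \<le> 1 - cos (\<theta> + \<theta>') cos (\<theta> - \<theta>') = sin\<^sup>2 \<theta> + sin\<^sup>2 \<theta>'\<close>, valid if
\<open>cos (\<theta> + \<theta>') \<ge> 0\<close>; otherwise the right hand side is at least \<open>N\<close> and the bound is trivial
because \<open>\<sigma>\<close> and \<open>s\<close> are not negative. Nonnegativity of \<open>s\<close> also deals with cosines of opposite
signs.\<close>

lemma cosine_product_perturbation:
  fixes \<sigma> s N x y :: real
  assumes \<sigma>: "0 \<le> \<sigma>" "\<sigma> \<le> N" and s: "0 \<le> s"
    and x: "x\<^sup>2 \<le> 1" and y: "y\<^sup>2 \<le> 1"
    and e: "\<bar>s - \<sigma> * x * y\<bar> \<le> N * (sqrt (1 - x\<^sup>2) * sqrt (1 - y\<^sup>2))"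
  shows "\<bar>\<sigma> - s\<bar> \<le> N * (2 - x\<^sup>2 - y\<^sup>2)"
proof -
  \<comment> \<open>\<open>z\<close> is the product of the sines, \<open>X\<close> that of the cosines up to sign.\<close>
  define z where "z = sqrt (1 - x\<^sup>2) * sqrt (1 - y\<^sup>2)"
  define X where "X = \<bar>x * y\<bar>"
  have z0: "0 \<le> z" and X0: "0 \<le> X" using x y by (auto simp: z_def X_def)
  have z2: "z\<^sup>2 = (1 - x\<^sup>2) * (1 - y\<^sup>2)" using x y by (simp add: z_def power_mult_distrib)
  have X2: "X\<^sup>2 = x\<^sup>2 * y\<^sup>2" by (simp add: X_def power_mult_distrib)
  have zle: "2 * z \<le> 2 - x\<^sup>2 - y\<^sup>2"
    using sum_squares_bound[of "sqrt (1 - x\<^sup>2)" "sqrt (1 - y\<^sup>2)"] x y by (simp add: z_def)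
  have Xle: "2 * X \<le> x\<^sup>2 + y\<^sup>2"
    using sum_squares_bound[of "\<bar>x\<bar>" "\<bar>y\<bar>"] by (simp add: X_def abs_mult)
  have N: "0 \<le> N" using \<sigma> by simp
  have X1: "X \<le> 1" using Xle x y by linarith
  have xy: "x * y \<le> X" "- X \<le> x * y" by (auto simp: X_def)
  have e': "\<bar>s - \<sigma> * (x * y)\<bar> \<le> N * z" using e by (simp add: z_def mult.assoc)
  have up: "s - \<sigma> \<le> N * (2 - x\<^sup>2 - y\<^sup>2)"
  proof -
    have "\<sigma> * (x * y) \<le> \<sigma> * 1" using \<sigma> xy X1 by (intro mult_left_mono) auto
    then have "s - \<sigma> \<le> N * z" using e' by auto
    also have "\<dots> \<le> N * (2 - x\<^sup>2 - y\<^sup>2)" using N zle z0 by (intro mult_left_mono) auto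
    finally show ?thesis .
  qed
  have low: "\<sigma> - s \<le> N * (2 - x\<^sup>2 - y\<^sup>2)"
  proof (cases "x\<^sup>2 + y\<^sup>2 \<le> 1")
    case True
    have "\<sigma> - s \<le> N * 1" using \<sigma> s by simp
    also have "\<dots> \<le> N * (2 - x\<^sup>2 - y\<^sup>2)" using N True by (intro mult_left_mono) auto
    finally show ?thesis .
  next
    case False
    have "\<sigma> - s \<le> \<sigma> * (1 - X) + N * z"
    proof (cases "0 \<le> x * y")
      case True
      then have "X = x * y" by (simp add: X_def)
      then show ?thesis using e' by (auto simp: algebra_simps)
    next
      case False
      then have "X = - (x * y)" by (simp add: X_def)
      then have "\<sigma> * X \<le> N * z" using e' s by auto
      then show ?thesis using s by (simp add: algebra_simps)
    qed
    also have "\<dots> \<le> N * (1 - X) + N * z" using \<sigma> X1 by (intro add_right_mono mult_right_mono) auto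
    also have "\<dots> = N * (1 - (X - z))" by (simp add: algebra_simps)
    also have "\<dots> \<le> N * (2 - x\<^sup>2 - y\<^sup>2)"
    proof (rule mult_left_mono[OF _ N])
      \<comment> \<open>\<open>X - z\<close> and \<open>X + z\<close> are the cosines of the sum and of the difference of the angles.\<close>
      have D1: "X + z \<le> 1" using zle Xle by linarith
      have CD: "(X - z) * (X + z) = x\<^sup>2 + y\<^sup>2 - 1"
        using X2 z2 by (simp add: power2_eq_square algebra_simps)
      have "0 \<le> X - z"
      proof (rule ccontr)
        assume "\<not> 0 \<le> X - z"
        then have "(X - z) * (X + z) \<le> 0" using X0 z0 by (intro mult_nonpos_nonneg) auto
        then show False using CD False by simp
      qed
      then have "(X - z) * (X + z) \<le> (X - z) * 1" using D1 by (intro mult_left_mono)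
      then show "1 - (X - z) \<le> 2 - x\<^sup>2 - y\<^sup>2" unfolding CD by simp
    qed
    finally show ?thesis .
  qed
  show ?thesis using up low by (simp add: abs_le_iff)
qed

text \<open>As \<open>A\<close> and its transpose map the orthogonal complements of \<open>v\<close> and \<open>u\<close> into each other,
splitting \<open>v'\<close> and \<open>u'\<close> along \<open>v\<close> and \<open>u\<close> produces no mixed terms: \<open>s\<close> is the sum of
\<open>\<sigma> (u' \<bullet> u) (v' \<bullet> v)\<close> and a term in the two orthogonal components, whose lengths are the
sines.\<close>

lemma ritz_value_error:
  assumes A: "A \<in> carrier_mat m n"
    and u: "u \<in> carrier_vec m" "u \<bullet> u = 1" and v: "v \<in> carrier_vec n" "v \<bullet> v = 1"
    and u': "u' \<in> carrier_vec m" "u' \<bullet> u' = 1" and v': "v' \<in> carrier_vec n" "v' \<bullet> v' = 1"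
    and Av: "A *\<^sub>v v = \<sigma> \<cdot>\<^sub>v u" and Au: "A\<^sup>T *\<^sub>v u = \<sigma> \<cdot>\<^sub>v v" and \<sigma>: "0 \<le> \<sigma>"
    and s: "s = u' \<bullet> (A *\<^sub>v v')" "0 \<le> s"
  shows "\<bar>\<sigma> - s\<bar> \<le> norm2_mat A * ((1 - (u' \<bullet> u)\<^sup>2) + (1 - (v' \<bullet> v)\<^sup>2))"
proof -
  define x where "x = u' \<bullet> u"
  define y where "y = v' \<bullet> v"
  define uo where "uo = u' - x \<cdot>\<^sub>v u"
  define vo where "vo = v' - y \<cdot>\<^sub>v v"
  have uoc: "uo \<in> carrier_vec m" and voc: "vo \<in> carrier_vec n"
    using u u' v v' by (auto simp: uo_def vo_def)
  have x1: "x\<^sup>2 \<le> 1" using cauchy_schwarz_vec[OF u'(1) u(1)] u u' by (simp add: x_def)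
  have y1: "y\<^sup>2 \<le> 1" using cauchy_schwarz_vec[OF v'(1) v(1)] v v' by (simp add: y_def)
  have "uo \<bullet> uo = u' \<bullet> u' - 2 * (u' \<bullet> (x \<cdot>\<^sub>v u)) + (x \<cdot>\<^sub>v u) \<bullet> (x \<cdot>\<^sub>v u)"
    unfolding uo_def using u u' by (intro scalar_prod_self_diff) auto
  then have uo2: "uo \<bullet> uo = 1 - x\<^sup>2"
    using u u' by (simp add: x_def power2_eq_square)
  have "vo \<bullet> vo = v' \<bullet> v' - 2 * (v' \<bullet> (y \<cdot>\<^sub>v v)) + (y \<cdot>\<^sub>v v) \<bullet> (y \<cdot>\<^sub>v v)"
    unfolding vo_def using v v' by (intro scalar_prod_self_diff) auto
  then have vo2: "vo \<bullet> vo = 1 - y\<^sup>2"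
    using v v' by (simp add: y_def power2_eq_square)
  \<comment> \<open>This is where the equation for the transpose enters.\<close>
  have uAw: "u \<bullet> (A *\<^sub>v w) = \<sigma> * (v \<bullet> w)" if "w \<in> carrier_vec n" for w
    using transpose_vec_mult_scalar[OF A that u(1)] Au v that by simp
  have "A *\<^sub>v vo = A *\<^sub>v v' - (y * \<sigma>) \<cdot>\<^sub>v u"
    unfolding vo_def using A v v' u
    by (simp add: mult_minus_distrib_mat_vec[OF A] mult_mat_vec[OF A] Av smult_smult_assoc)
  then have "u' \<bullet> (A *\<^sub>v vo) = s - y * \<sigma> * x"
    using A v' u u' by (simp add: scalar_prod_minus_distrib[of _ m] s x_def)
  moreover have "u \<bullet> (A *\<^sub>v vo) = 0"
    unfolding uAw[OF voc] unfolding vo_def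
    using v v' by (simp add: scalar_prod_minus_distrib[of _ n] y_def comm_scalar_prod[of v n v'])
  moreover have "uo \<bullet> (A *\<^sub>v vo) = u' \<bullet> (A *\<^sub>v vo) - x * (u \<bullet> (A *\<^sub>v vo))"
    unfolding uo_def using u u' A voc by (subst minus_scalar_prod_distrib[of _ m]) auto
  ultimately have "uo \<bullet> (A *\<^sub>v vo) = s - \<sigma> * x * y" by simp
  then have e: "\<bar>s - \<sigma> * x * y\<bar> \<le> norm2_mat A * (sqrt (1 - x\<^sup>2) * sqrt (1 - y\<^sup>2))"
    using norm2_mat_bilinear[OF A voc uoc] by (simp add: norm2_vec_def uo2 vo2)
  have "\<sigma> \<le> norm2_mat A"
    using norm2_mat_bilinear[OF A v(1) u(1)] uAw[OF v(1)] u v by (simp add: norm2_vec_def)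
  from cosine_product_perturbation[OF \<sigma> this s(2) x1 y1 e]
  show ?thesis by (simp add: x_def y_def algebra_simps)
qed

section \<open>Eigenvectors of the augmented matrix\<close>

lemma mult_unit_vec_col:
  assumes "(M :: real mat) \<in> carrier_mat n p" "j < p"
  shows "M *\<^sub>v unit_vec p j = col M j"
  using assms by (intro eq_vecI) auto

lemma col_diagonal:
  assumes S: "(S :: real mat) \<in> carrier_mat m n" "diagonal_mat S" and j: "j < n" "j < m"
  shows "col S j = S $$ (j, j) \<cdot>\<^sub>v unit_vec m j"
  using assms by (intro eq_vecI) (auto simp: diagonal_mat_def unit_vec_def)

lemma orthonormal_transpose_mult_col:
  assumes "T \<in> carrier_mat n p" "orthonormal_cols T" "j < p"
  shows "T\<^sup>T *\<^sub>v col T j = unit_vec p j"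
  using orthonormal_cancel[OF assms(1,2), of "unit_vec p j"] mult_unit_vec_col[OF assms(1,3)] by simp

lemma svd_mult_right_vec:
  assumes A: "A \<in> carrier_mat m n" and svd: "is_svd A U S V" and j: "j < n"
  shows "A *\<^sub>v col V j = U *\<^sub>v col S j"
proof -
  have c: "U \<in> carrier_mat m m" "S \<in> carrier_mat m n" "V\<^sup>T \<in> carrier_mat n n"
    and V: "V \<in> carrier_mat n n" "orthonormal_cols V" and Aeq: "A = U * S * V\<^sup>T"
    using svd A by (auto simp: is_svd_def)
  have "A *\<^sub>v col V j = U *\<^sub>v (S *\<^sub>v (V\<^sup>T *\<^sub>v col V j))"
    unfolding Aeq using V by (intro mult3_mat_vec[OF c]) auto
  then show ?thesis
    by (simp add: orthonormal_transpose_mult_col[OF V j] mult_unit_vec_col[OF c(2) j])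
qed

lemma svd_mult_left_vec:
  assumes A: "A \<in> carrier_mat m n" and svd: "is_svd A U S V" and j: "j < m"
  shows "A\<^sup>T *\<^sub>v col U j = V *\<^sub>v col (S\<^sup>T) j"
proof -
  have c: "V \<in> carrier_mat n n" "S\<^sup>T \<in> carrier_mat n m" "U\<^sup>T \<in> carrier_mat m m"
    and U: "U \<in> carrier_mat m m" "orthonormal_cols U" and S: "S \<in> carrier_mat m n"
    and Aeq: "A = U * S * V\<^sup>T"
    using svd A by (auto simp: is_svd_def)
  have "A\<^sup>T = V * S\<^sup>T * U\<^sup>T"
    unfolding Aeq using c(1) U S by (subst transpose_mult3[of _ m m _ n _ n]) auto
  then have "A\<^sup>T *\<^sub>v col U j = V *\<^sub>v (S\<^sup>T *\<^sub>v (U\<^sup>T *\<^sub>v col U j))"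
    using U by (simp only:) (intro mult3_mat_vec[OF c], auto)
  then show ?thesis
    by (simp only: orthonormal_transpose_mult_col[OF U j] mult_unit_vec_col[OF c(2) j])
qed

lemma svd_singular_pair:
  assumes A: "A \<in> carrier_mat m n" and mn: "n \<le> m" and svd: "is_svd A U S V" and j: "j < n"
  shows "A *\<^sub>v col V j = S $$ (j, j) \<cdot>\<^sub>v col U j"
    and "A\<^sup>T *\<^sub>v col U j = S $$ (j, j) \<cdot>\<^sub>v col V j"
proof -
  have U: "U \<in> carrier_mat m m" and V: "V \<in> carrier_mat n n"
    and S: "S \<in> carrier_mat m n" "diagonal_mat S"
    using svd A by (auto simp: is_svd_def)
  have jm: "j < m" using j mn by simp
  have St: "S\<^sup>T \<in> carrier_mat n m" "diagonal_mat (S\<^sup>T)"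
    using S by (auto simp: diagonal_mat_def)
  show "A *\<^sub>v col V j = S $$ (j, j) \<cdot>\<^sub>v col U j"
    unfolding svd_mult_right_vec[OF A svd j] col_diagonal[OF S j jm]
    using U jm by (simp add: mult_mat_vec[of U m m] mult_unit_vec_col[OF U])
  have "S\<^sup>T $$ (j, j) = S $$ (j, j)" using S j jm by simp
  then show "A\<^sup>T *\<^sub>v col U j = S $$ (j, j) \<cdot>\<^sub>v col V j"
    unfolding svd_mult_left_vec[OF A svd jm] col_diagonal[OF St jm j]
    using V j by (simp add: mult_mat_vec[of V n n] mult_unit_vec_col[OF V])
qed

lemma svd_left_null:
  assumes A: "A \<in> carrier_mat m n" and svd: "is_svd A U S V" and j: "n \<le> j" "j < m"
  shows "A\<^sup>T *\<^sub>v col U j = 0\<^sub>v n"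
proof -
  have V: "V \<in> carrier_mat n n" and S: "S \<in> carrier_mat m n" "diagonal_mat S"
    using svd A by (auto simp: is_svd_def)
  have "col (S\<^sup>T) j = 0\<^sub>v n"
    using S j by (intro eq_vecI) (auto simp: diagonal_mat_def)
  then show ?thesis
    unfolding svd_mult_left_vec[OF A svd j(2)] using mult_mat_zero_vec[OF V] by simp
qed

lemma col_aug_eigvecs:
  assumes U: "U \<in> carrier_mat m m" and V: "V \<in> carrier_mat n n" and mn: "n \<le> m" and j: "j < m + n"
  shows "col (aug_eigvecs U V) j = (1 / sqrt 2) \<cdot>\<^sub>v
    (if j < n then col V j @\<^sub>v col U j
     else if j < 2 * n then col V (j - n) @\<^sub>v - col U (j - n)
     else 0\<^sub>v n @\<^sub>v sqrt 2 \<cdot>\<^sub>v col U (j - n))" (is "_ = _ \<cdot>\<^sub>v ?w")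
proof -
  let ?L = "map (\<lambda>j. col V j @\<^sub>v col U j) [0..<n] @
         map (\<lambda>j. col V j @\<^sub>v - col U j) [0..<n] @
         map (\<lambda>j. 0\<^sub>v n @\<^sub>v sqrt 2 \<cdot>\<^sub>v col U j) [n..<m]"
  have len: "j < length ?L" using j mn by simp
  have nth: "?L ! j = ?w" using j mn by (auto simp: nth_append not_less mult_2)
  have wc: "?w \<in> carrier_vec (m + n)" using U V by (auto intro!: carrier_vecI)
  have "col (aug_eigvecs U V) j = (1 / sqrt 2) \<cdot>\<^sub>v col (mat_of_cols (m + n) ?L) j"
    using U V len j by (intro eq_vecI) (auto simp: aug_eigvecs_def Let_def)
  also have "col (mat_of_cols (m + n) ?L) j = ?w"
    using len wc unfolding nth[symmetric] by (intro col_mat_of_cols)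
  finally show ?thesis .
qed

lemma aug_eigvecs_carrier:
  assumes "U \<in> carrier_mat m m" "V \<in> carrier_mat n n" "n \<le> m"
  shows "aug_eigvecs U V \<in> carrier_mat (m + n) (m + n)"
  using assms by (auto simp: aug_eigvecs_def Let_def)

lemma aug_eigvecs_orthonormal:
  assumes U: "U \<in> carrier_mat m m" "orthonormal_cols U"
    and V: "V \<in> carrier_mat n n" "orthonormal_cols V" and mn: "n \<le> m"
  shows "orthonormal_cols (aug_eigvecs U V)"
  unfolding orthonormal_cols_iff[OF aug_eigvecs_carrier[OF U(1) V(1) mn]]
proof (intro allI impI)
  fix i j assume i: "i < m + n" and j: "j < m + n"
  have u: "col U a \<bullet> col U b = (if a = b then 1 else 0)" if "a < m" "b < m" for a b
    using orthonormal_cols_iff[OF U(1)] U(2) that by auto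
  have v: "col V a \<bullet> col V b = (if a = b then 1 else 0)" if "a < n" "b < n" for a b
    using orthonormal_cols_iff[OF V(1)] V(2) that by auto
  have [simp]: "col U a \<in> carrier_vec m" "col V a \<in> carrier_vec n"
      "dim_row U = m" "dim_row V = n" for a
    using U V by auto
  show "col (aug_eigvecs U V) i \<bullet> col (aug_eigvecs U V) j = (if i = j then 1 else 0)"
    unfolding col_aug_eigvecs[OF U(1) V(1) mn i] col_aug_eigvecs[OF U(1) V(1) mn j]
    using i j mn
    by (auto simp: scalar_prod_append[of _ n _ m] u v)
qed

lemma aug_mat_eigvec:
  assumes A: "A \<in> carrier_mat m n" and mn: "n \<le> m" and svd: "is_svd A U S V" and j: "j < m + n"
  shows "aug_mat A *\<^sub>v col (aug_eigvecs U V) j = aug_eigval S j \<cdot>\<^sub>v col (aug_eigvecs U V) j"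
proof -
  have U: "U \<in> carrier_mat m m" and V: "V \<in> carrier_mat n n" and S: "dim_col S = n"
    using svd A by (auto simp: is_svd_def)
  have Uc: "col U a \<in> carrier_vec m" and Vc: "col V a \<in> carrier_vec n" for a using U V by auto
  have At: "A\<^sup>T \<in> carrier_mat n m" using A by simp
  have z: "A *\<^sub>v 0\<^sub>v n = 0\<^sub>v m" by (rule mult_mat_zero_vec[OF A])
  let ?w = "if j < n then col V j @\<^sub>v col U j
     else if j < 2 * n then col V (j - n) @\<^sub>v - col U (j - n)
     else 0\<^sub>v n @\<^sub>v sqrt 2 \<cdot>\<^sub>v col U (j - n)"
  have wc: "?w \<in> carrier_vec (n + m)" using Uc Vc by auto
  have "aug_mat A *\<^sub>v ?w = aug_eigval S j \<cdot>\<^sub>v ?w"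
  proof -
    consider "j < n" | "n \<le> j" "j < 2 * n" | "2 * n \<le> j" by linarith
    then show ?thesis
    proof cases
      case 1
      then show ?thesis
        by (simp add: aug_mat_mult_vec[OF A Vc Uc] svd_singular_pair[OF A mn svd]
            aug_eigval_def S append_vec_smult)
    next
      case 2
      then have jn: "j - n < n" by linarith
      have "A\<^sup>T *\<^sub>v (- col U (j - n)) = - S $$ (j - n, j - n) \<cdot>\<^sub>v col V (j - n)"
      proof -
        have "- col U (j - n) = (-1) \<cdot>\<^sub>v col U (j - n)" by (intro eq_vecI) auto
        then show ?thesis
          using mult_mat_vec[OF At Uc, of "-1"] svd_singular_pair(2)[OF A mn svd jn]
          by (simp add: smult_smult_assoc)
      qed
      moreover have "- S $$ (j - n, j - n) \<cdot>\<^sub>v - col U (j - n) = S $$ (j - n, j - n) \<cdot>\<^sub>v col U (j - n)"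
        by (intro eq_vecI) auto
      moreover have "- col U (j - n) \<in> carrier_vec m" using Uc by auto
      ultimately show ?thesis using 2
        by (simp add: aug_mat_mult_vec[OF A Vc] svd_singular_pair(1)[OF A mn svd jn]
            aug_eigval_def S append_vec_smult)
    next
      case 3
      have "A\<^sup>T *\<^sub>v (sqrt 2 \<cdot>\<^sub>v col U (j - n)) = 0\<^sub>v n"
        using 3 j svd_left_null[OF A svd, of "j - n"] by (simp add: mult_mat_vec[OF At Uc]) (intro eq_vecI, auto)
      moreover have "sqrt 2 \<cdot>\<^sub>v col U (j - n) \<in> carrier_vec m" using Uc by auto
      ultimately show ?thesis using 3
        by (simp add: aug_mat_mult_vec[OF A] z aug_eigval_def S append_vec_smult)
           (intro eq_vecI, use U in auto)
    qed
  qed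
  then show ?thesis
    unfolding col_aug_eigvecs[OF U V mn j]
    using mult_mat_vec[OF aug_mat_carrier[OF A] wc]
    by (simp add: smult_smult_assoc mult.commute)
qed

lemma aug_mat_symmetric: "(aug_mat A)\<^sup>T = aug_mat A"
  unfolding aug_mat_def
  by (subst transpose_four_block_mat[of _ "dim_col A" "dim_col A" _ "dim_row A" _ "dim_row A"]) auto

section \<open>Subspace iteration with a polynomial filter\<close>

lemma left_eigvec_power:
  fixes M :: "real mat"
  assumes M: "M \<in> carrier_mat N N" and q: "q \<in> carrier_vec N" "M\<^sup>T *\<^sub>v q = \<mu> \<cdot>\<^sub>v q"
    and x: "x \<in> carrier_vec N"
  shows "q \<bullet> ((M ^\<^sub>m e) *\<^sub>v x) = \<mu> ^ e * (q \<bullet> x)"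
  using x
proof (induction e arbitrary: x)
  case 0
  then show ?case using M by simp
next
  case (Suc e)
  have "(M ^\<^sub>m Suc e) *\<^sub>v x = (M ^\<^sub>m e) *\<^sub>v (M *\<^sub>v x)"
    using M Suc.prems by (simp add: assoc_mult_mat_vec[of _ N N _ N])
  then have "q \<bullet> ((M ^\<^sub>m Suc e) *\<^sub>v x) = \<mu> ^ e * (q \<bullet> (M *\<^sub>v x))"
    using Suc M by simp
  also have "q \<bullet> (M *\<^sub>v x) = \<mu> * (q \<bullet> x)"
    using transpose_vec_mult_scalar[OF M Suc.prems q(1)] q Suc.prems by simp
  finally show ?case by simp
qed

text \<open>Only the action of the filter on components along eigenvectors is needed, and there a left
eigenvector of \<open>M\<close> suffices.\<close>

lemma left_eigvec_eval_poly:
  assumes M: "M \<in> carrier_mat N N" and q: "q \<in> carrier_vec N" "M\<^sup>T *\<^sub>v q = \<mu> \<cdot>\<^sub>v q"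
    and x: "x \<in> carrier_vec N"
  shows "q \<bullet> (eval_poly_mat f M *\<^sub>v x) = poly f \<mu> * (q \<bullet> x)"
proof -
  let ?d = "Polynomial.degree f"
  have "(eval_poly_mat f M *\<^sub>v x) $ i
      = (\<Sum>e\<le>?d. Polynomial.coeff f e * ((M ^\<^sub>m e) *\<^sub>v x) $ i)" if i: "i < N" for i
  proof -
    have "(eval_poly_mat f M *\<^sub>v x) $ i
        = (\<Sum>k<N. (\<Sum>e\<le>?d. Polynomial.coeff f e * (M ^\<^sub>m e) $$ (i, k)) * x $ k)"
      using i M x by (simp add: eval_poly_mat_def scalar_prod_def lessThan_atLeast0)
    also have "\<dots> = (\<Sum>k<N. \<Sum>e\<le>?d. Polynomial.coeff f e * ((M ^\<^sub>m e) $$ (i, k) * x $ k))"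
      by (simp add: sum_distrib_right mult.assoc)
    also have "\<dots> = (\<Sum>e\<le>?d. \<Sum>k<N. Polynomial.coeff f e * ((M ^\<^sub>m e) $$ (i, k) * x $ k))"
      by (rule sum.swap)
    also have "\<dots> = (\<Sum>e\<le>?d. Polynomial.coeff f e * ((M ^\<^sub>m e) *\<^sub>v x) $ i)"
      using i M x pow_carrier_mat[OF M]
      by (intro sum.cong refl) (auto simp: scalar_prod_def lessThan_atLeast0 sum_distrib_left intro!: sum.cong)
    finally show ?thesis .
  qed
  then have "q \<bullet> (eval_poly_mat f M *\<^sub>v x)
      = (\<Sum>i<N. q $ i * (\<Sum>e\<le>?d. Polynomial.coeff f e * ((M ^\<^sub>m e) *\<^sub>v x) $ i))"
    using M by (simp add: scalar_prod_def lessThan_atLeast0 eval_poly_mat_def)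
  also have "\<dots> = (\<Sum>i<N. \<Sum>e\<le>?d. Polynomial.coeff f e * (q $ i * ((M ^\<^sub>m e) *\<^sub>v x) $ i))"
    by (simp add: sum_distrib_left mult.left_commute)
  also have "\<dots> = (\<Sum>e\<le>?d. \<Sum>i<N. Polynomial.coeff f e * (q $ i * ((M ^\<^sub>m e) *\<^sub>v x) $ i))"
    by (rule sum.swap)
  also have "\<dots> = (\<Sum>e\<le>?d. Polynomial.coeff f e * (q \<bullet> ((M ^\<^sub>m e) *\<^sub>v x)))"
    using M by (simp add: scalar_prod_def lessThan_atLeast0 sum_distrib_left del: index_mult_mat_vec)
  also have "\<dots> = (\<Sum>e\<le>?d. Polynomial.coeff f e * \<mu> ^ e) * (q \<bullet> x)"
    by (simp add: left_eigvec_power[OF M q x] sum_distrib_right mult.assoc)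
  finally show ?thesis by (simp add: poly_altdef)
qed

lemma iterate_carrier:
  fixes P :: "real mat" and Qt R :: "nat \<Rightarrow> real mat"
  assumes P: "P \<in> carrier_mat N N" and Qt0: "Qt 0 \<in> carrier_mat N p"
    and qr: "\<And>k. k \<ge> 1 \<Longrightarrow> is_thin_qr (P * Qt (k - 1)) (Qt k) (R k)"
  shows "Qt k \<in> carrier_mat N p"
proof (induction k)
  case (Suc k)
  then show ?case using qr[of "Suc k"] P by (auto simp: is_thin_qr_def)
qed (rule Qt0)

text \<open>Let \<open>w\<close> be the element of the initial space whose components along the first \<open>p\<close>
eigenvectors are those of \<open>col H i\<close>; its other components form column \<open>i\<close> of \<open>E0\<close>. Each step
multiplies the component along \<open>col H j\<close> by \<open>\<gamma> j\<close>, and the QR factorizations keep the image of \<open>w\<close>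
in the span of the iterate. After division by \<open>\<gamma> i ^ k\<close> only the components with \<open>j \<ge> p\<close>
distinguish that image from \<open>col H i\<close>, and each of them has shrunk at least by the factor
\<open>(\<gamma> p / \<gamma> i) ^ k\<close>.\<close>

lemma subspace_iteration_error:
  fixes H P E0 :: "real mat" and Qt R :: "nat \<Rightarrow> real mat" and \<gamma> :: "nat \<Rightarrow> real"
  assumes H: "H \<in> carrier_mat N N" "orthonormal_cols H"
    and P: "P \<in> carrier_mat N N"
    and spec: "\<And>j x. j < N \<Longrightarrow> x \<in> carrier_vec N \<Longrightarrow> col H j \<bullet> (P *\<^sub>v x) = \<gamma> j * (col H j \<bullet> x)"
    and dec: "\<And>j. p \<le> j \<Longrightarrow> j < N \<Longrightarrow> \<gamma> j \<le> \<gamma> p" and nonneg: "\<And>j. j < N \<Longrightarrow> 0 \<le> \<gamma> j"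
    and pN: "p \<le> N"
    and Qt0: "Qt 0 \<in> carrier_mat N p"
    and qr: "\<And>k. k \<ge> 1 \<Longrightarrow> is_thin_qr (P * Qt (k - 1)) (Qt k) (R k)"
    and inv: "invertible_mat ((mat_of_cols N (map (col H) [0..<p]))\<^sup>T * Qt 0)"
    and E0: "E0 = ((mat_of_cols N (map (col H) [p..<N]))\<^sup>T * Qt 0)
      * the (mat_inverse ((mat_of_cols N (map (col H) [0..<p]))\<^sup>T * Qt 0))"
    and i: "i < p" "0 < \<gamma> i"
  shows "\<exists>z \<in> carrier_vec p. (col H i - Qt k *\<^sub>v z) \<bullet> (col H i - Qt k *\<^sub>v z)
    \<le> (\<gamma> p / \<gamma> i) ^ (2 * k) * (norm2_mat E0)\<^sup>2"
proof -
  define Qp where "Qp = mat_of_cols N (map (col H) [0..<p])"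
  define Qo where "Qo = mat_of_cols N (map (col H) [p..<N])"
  define G where "G = Qp\<^sup>T * Qt 0"
  define M where "M = the (mat_inverse G)"
  have Hc: "col H j \<in> carrier_vec N" for j using H by auto
  have Qp: "Qp \<in> carrier_mat N p" and Qo: "Qo \<in> carrier_mat N (N - p)"
    by (auto simp: Qp_def Qo_def)
  have cp: "col Qp j = col H j" if "j < p" for j
    unfolding Qp_def using that Hc by (subst col_mat_of_cols) auto
  have co: "col Qo j = col H (p + j)" if "j < N - p" for j
    unfolding Qo_def using that Hc by (subst col_mat_of_cols) auto
  have Gc: "G \<in> carrier_mat p p" using Qp Qt0 by (auto simp: G_def)
  have M: "M \<in> carrier_mat p p" "G * M = 1\<^sub>m p"
  proof -
    obtain B where B: "inverts_mat G B" "inverts_mat B G"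
      using inv by (auto simp: invertible_mat_def G_def Qp_def)
    have GB: "G * B = 1\<^sub>m p" using B(1) Gc by (simp add: inverts_mat_def)
    have "dim_col B = p" using arg_cong[OF GB, of dim_col] by simp
    moreover have "dim_row B = p"
      using B(2) Gc unfolding inverts_mat_def by (metis carrier_matD(2) index_mult_mat(3) index_one_mat(3))
    ultimately have Bc: "B \<in> carrier_mat p p" by auto
    have BG: "B * G = 1\<^sub>m p" using B(2) Bc by (simp add: inverts_mat_def)
    have "G \<in> Units (ring_mat TYPE(real) p ())"
      using Gc Bc GB BG by (auto simp: Units_def ring_mat_def)
    then obtain B' where "mat_inverse G = Some B'"
      using mat_inverse(1)[OF Gc, of "()"] by (cases "mat_inverse G") auto
    then show "M \<in> carrier_mat p p" "G * M = 1\<^sub>m p"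
      using mat_inverse(2)[OF Gc] by (auto simp: M_def)
  qed
  have E: "E0 = (Qo\<^sup>T * Qt 0) * M" by (simp add: E0 M_def G_def Qp_def Qo_def)
  define e where "e = (unit_vec p i :: real vec)"
  have ec: "e \<in> carrier_vec p" by (simp add: e_def)
  \<comment> \<open>\<open>g\<close> holds the coordinates of \<open>w\<close> in the basis \<open>Qt 0\<close>.\<close>
  define g where "g = M *\<^sub>v e"
  have gc: "g \<in> carrier_vec p" using M ec by (auto simp: g_def)
  define w where "w = Qt 0 *\<^sub>v g"
  have wc: "w \<in> carrier_vec N" using Qt0 gc by (auto simp: w_def)
  have Qpw: "Qp\<^sup>T *\<^sub>v w = e"
  proof -
    have "Qp\<^sup>T *\<^sub>v w = G *\<^sub>v g"
      unfolding w_def G_def using Qp Qt0 gc by (intro assoc_mult_mat_vec[symmetric]) auto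
    also have "\<dots> = (G * M) *\<^sub>v e"
      unfolding g_def using Gc M ec by (intro assoc_mult_mat_vec[symmetric]) auto
    finally show ?thesis using M ec by simp
  qed
  have Qow: "Qo\<^sup>T *\<^sub>v w = E0 *\<^sub>v e"
  proof -
    have "Qo\<^sup>T *\<^sub>v w = (Qo\<^sup>T * Qt 0) *\<^sub>v g"
      unfolding w_def using Qo Qt0 gc by (intro assoc_mult_mat_vec[symmetric]) auto
    also have "\<dots> = E0 *\<^sub>v e"
      unfolding g_def E using Qo Qt0 M ec by (intro assoc_mult_mat_vec[symmetric]) auto
    finally show ?thesis .
  qed
  have wp: "col H j \<bullet> w = (if j = i then 1 else 0)" if "j < p" for j
    using arg_cong[OF Qpw, of "\<lambda>v. v $ j"] that Qp cp by (simp add: e_def i)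
  have wo: "col H (p + j) \<bullet> w = (E0 *\<^sub>v e) $ j" if "j < N - p" for j
    using arg_cong[OF Qow, of "\<lambda>v. v $ j"] that Qo co[OF that] by simp
  define wk where "wk = (\<lambda>k. ((\<lambda>x. P *\<^sub>v x) ^^ k) w)"
  have wkS: "wk (Suc k) = P *\<^sub>v wk k" for k by (simp add: wk_def)
  have wkc: "wk k \<in> carrier_vec N" for k
    by (induction k) (use wc P in \<open>auto simp: wk_def\<close>)
  have Qtc: "Qt k \<in> carrier_mat N p" for k
    using P Qt0 qr by (rule iterate_carrier)
  have range: "\<exists>z \<in> carrier_vec p. wk k = Qt k *\<^sub>v z" for k
  proof (induction k)
    case 0
    then show ?case using gc by (auto simp: wk_def w_def)
  next
    case (Suc k)
    then obtain z where z: "z \<in> carrier_vec p" "wk k = Qt k *\<^sub>v z" by blast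
    have R: "R (Suc k) \<in> carrier_mat p p" "P * Qt k = Qt (Suc k) * R (Suc k)"
      using qr[of "Suc k"] Qtc[of k] by (auto simp: is_thin_qr_def)
    have "wk (Suc k) = (P * Qt k) *\<^sub>v z"
      unfolding wkS z(2) using P Qtc z by (intro assoc_mult_mat_vec[symmetric]) auto
    also have "\<dots> = Qt (Suc k) *\<^sub>v (R (Suc k) *\<^sub>v z)"
      unfolding R(2) using R(1) Qtc z by (intro assoc_mult_mat_vec) auto
    finally show ?case using R z by auto
  qed
  have coef: "col H j \<bullet> wk k = \<gamma> j ^ k * (col H j \<bullet> w)" if "j < N" for j k
    by (induction k) (use that wkc spec in \<open>auto simp: wkS, simp add: wk_def\<close>)
  define t where "t = 1 / \<gamma> i ^ k"
  define y where "y = col H i - t \<cdot>\<^sub>v wk k"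
  have yc: "y \<in> carrier_vec N" using Hc wkc by (auto simp: y_def)
  have iN: "i < N" using i pN by simp
  have HH: "col H j \<bullet> col H i = (if j = i then 1 else 0)" if "j < N" for j
    using orthonormal_cols_iff[OF H(1)] H(2) that iN by auto
  have coefy: "col H j \<bullet> y = (if j = i then 1 else 0) - (\<gamma> j / \<gamma> i) ^ k * (col H j \<bullet> w)" if "j < N" for j
  proof -
    have "col H j \<bullet> y = col H j \<bullet> col H i - t * (col H j \<bullet> wk k)"
      unfolding y_def using Hc[of i] Hc[of j] wkc[of k]
      by (simp add: scalar_prod_minus_distrib[of _ N] scalar_prod_smult_distrib[of _ N])
    then show ?thesis using HH[OF that] coef[OF that] by (simp add: t_def power_divide)
  qed
  have y0: "col H j \<bullet> y = 0" if "j < p" for j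
    using that i pN coefy[of j] wp[OF that] by auto
  have "y \<bullet> y = (\<Sum>j<N. (col H j \<bullet> y)\<^sup>2)" by (rule parseval[OF H yc, symmetric])
  also have "\<dots> = (\<Sum>j\<in>{p..<N}. (col H j \<bullet> y)\<^sup>2)"
    using pN y0 by (intro sum.mono_neutral_right) auto
  also have "\<dots> \<le> (\<Sum>j\<in>{p..<N}. (\<gamma> p / \<gamma> i) ^ (2 * k) * (col H j \<bullet> w)\<^sup>2)"
  proof (rule sum_mono)
    fix j assume "j \<in> {p..<N}"
    then have j: "p \<le> j" "j < N" by auto
    have "(col H j \<bullet> y)\<^sup>2 = (\<gamma> j / \<gamma> i) ^ (2 * k) * (col H j \<bullet> w)\<^sup>2"
      using coefy[OF j(2)] j i by (simp add: power_mult_distrib power_even_eq power_mult[symmetric] mult.commute)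
    also have "\<dots> \<le> (\<gamma> p / \<gamma> i) ^ (2 * k) * (col H j \<bullet> w)\<^sup>2"
      using dec[OF j] nonneg[OF j(2)] i by (intro mult_right_mono power_mono divide_right_mono) auto
    finally show "(col H j \<bullet> y)\<^sup>2 \<le> (\<gamma> p / \<gamma> i) ^ (2 * k) * (col H j \<bullet> w)\<^sup>2" .
  qed
  also have "\<dots> = (\<gamma> p / \<gamma> i) ^ (2 * k) * (\<Sum>j\<in>{p..<N}. (col H j \<bullet> w)\<^sup>2)"
    by (simp add: sum_distrib_left)
  also have "(\<Sum>j\<in>{p..<N}. (col H j \<bullet> w)\<^sup>2) = (\<Sum>j<N - p. (col H (p + j) \<bullet> w)\<^sup>2)"
    by (rule sum.reindex_bij_witness[of _ "\<lambda>j. p + j" "\<lambda>j. j - p"]) auto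
  also have "\<dots> = (E0 *\<^sub>v e) \<bullet> (E0 *\<^sub>v e)"
  proof -
    have "dim_vec (E0 *\<^sub>v e) = N - p" using Qo by (simp add: E)
    then show ?thesis using wo by (simp add: scalar_prod_self_sum del: dim_mult_mat_vec index_mult_mat_vec)
  qed
  also have "(\<gamma> p / \<gamma> i) ^ (2 * k) * \<dots> \<le> (\<gamma> p / \<gamma> i) ^ (2 * k) * (norm2_mat E0)\<^sup>2"
  proof (rule mult_left_mono)
    have "(E0 *\<^sub>v e) \<bullet> (E0 *\<^sub>v e) \<le> (norm2_mat E0)\<^sup>2 * (e \<bullet> e)"
      using M ec by (intro norm2_mat_bound) (auto simp: E)
    then show "(E0 *\<^sub>v e) \<bullet> (E0 *\<^sub>v e) \<le> (norm2_mat E0)\<^sup>2" using i by (simp add: e_def)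
  qed (simp add: power_mult)
  finally have fin: "y \<bullet> y \<le> (\<gamma> p / \<gamma> i) ^ (2 * k) * (norm2_mat E0)\<^sup>2" .
  obtain z where z: "z \<in> carrier_vec p" "wk k = Qt k *\<^sub>v z" using range by blast
  have "y = col H i - Qt k *\<^sub>v (t \<cdot>\<^sub>v z)"
    unfolding y_def z(2) mult_mat_vec[OF Qtc z(1)] ..
  then show ?thesis using fin z by (intro bexI[of _ "t \<cdot>\<^sub>v z"]) auto
qed

section \<open>From the iterates to the spaces of singular vectors\<close>

lemma top_block_mult_vec:
  assumes a: "a \<in> carrier_vec n" and b: "b \<in> carrier_vec m"
  shows "(1\<^sub>m n @\<^sub>r 0\<^sub>m m n)\<^sup>T *\<^sub>v (a @\<^sub>v b) = (a :: real vec)"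
proof (rule eq_vecI)
  fix i assume "i < dim_vec a"
  then have i: "i < n" using a by simp
  have "col (1\<^sub>m n @\<^sub>r 0\<^sub>m m n) i = (unit_vec n i @\<^sub>v 0\<^sub>v m :: real vec)"
    using i by (intro eq_vecI) (auto simp: append_rows_def unit_vec_def)
  then show "((1\<^sub>m n @\<^sub>r 0\<^sub>m m n)\<^sup>T *\<^sub>v (a @\<^sub>v b)) $ i = a $ i"
    using i a b by (simp add: append_rows_def scalar_prod_append[of _ n _ m])
qed (use a in \<open>simp add: append_rows_def\<close>)

lemma bottom_block_mult_vec:
  assumes a: "a \<in> carrier_vec n" and b: "b \<in> carrier_vec m"
  shows "(0\<^sub>m n m @\<^sub>r 1\<^sub>m m)\<^sup>T *\<^sub>v (a @\<^sub>v b) = (b :: real vec)"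
proof (rule eq_vecI)
  fix i assume "i < dim_vec b"
  then have i: "i < m" using b by simp
  have "col (0\<^sub>m n m @\<^sub>r 1\<^sub>m m) i = (0\<^sub>v n @\<^sub>v unit_vec m i :: real vec)"
    using i by (intro eq_vecI) (auto simp: append_rows_def unit_vec_def)
  then show "((0\<^sub>m n m @\<^sub>r 1\<^sub>m m)\<^sup>T *\<^sub>v (a @\<^sub>v b)) $ i = b $ i"
    using i a b by (simp add: append_rows_def scalar_prod_append[of _ n _ m])
qed (use b in \<open>simp add: append_rows_def\<close>)


text \<open>The computed bases span the spaces of the upper and the lower parts of the elements of the iterate.
An approximation of \<open>q\<close> in the iterate therefore approximates \<open>v\<close> and \<open>u\<close> separately; the factor 2
undoes the normalization of \<open>q\<close>.\<close>

lemma defect_blocks_le: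
  assumes v: "v \<in> carrier_vec n" and u: "u \<in> carrier_vec m"
    and X: "X \<in> carrier_mat (m + n) p" and z: "z \<in> carrier_vec p"
    and qr1: "is_thin_qr ((1\<^sub>m n @\<^sub>r 0\<^sub>m m n)\<^sup>T * X) Q1 R1"
    and qr2: "is_thin_qr ((0\<^sub>m n m @\<^sub>r 1\<^sub>m m)\<^sup>T * X) Q2 R2"
    and q: "q = (1 / sqrt 2) \<cdot>\<^sub>v (v @\<^sub>v u)"
  shows "defect Q1 v + defect Q2 u \<le> 2 * ((q - X *\<^sub>v z) \<bullet> (q - X *\<^sub>v z))"
proof -
  define x where "x = X *\<^sub>v z"
  define a where "a = vec_first x n"
  define b where "b = vec_last x m"
  let ?I1 = "(1\<^sub>m n @\<^sub>r 0\<^sub>m m n)\<^sup>T :: real mat"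
  let ?I2 = "(0\<^sub>m n m @\<^sub>r 1\<^sub>m m)\<^sup>T :: real mat"
  have X': "X \<in> carrier_mat (n + m) p" using X by (simp add: add.commute)
  have xc: "x \<in> carrier_vec (n + m)" using X' z by (auto simp: x_def)
  have ac: "a \<in> carrier_vec n" and bc: "b \<in> carrier_vec m" by (simp_all add: a_def b_def)
  have xab: "x = a @\<^sub>v b" using xc by (simp add: a_def b_def)
  have I1: "?I1 \<in> carrier_mat n (n + m)" and I2: "?I2 \<in> carrier_mat m (n + m)"
    by (auto simp: append_rows_def)
  have Q1: "Q1 \<in> carrier_mat n p" "orthonormal_cols Q1" "R1 \<in> carrier_mat p p" "?I1 * X = Q1 * R1"
    using qr1 I1 X' unfolding is_thin_qr_def by (simp_all add: append_rows_def)
  have Q2: "Q2 \<in> carrier_mat m p" "orthonormal_cols Q2" "R2 \<in> carrier_mat p p" "?I2 * X = Q2 * R2"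
    using qr2 I2 X' unfolding is_thin_qr_def by (simp_all add: append_rows_def)
  have "a = ?I1 *\<^sub>v x" unfolding xab top_block_mult_vec[OF ac bc] ..
  also have "\<dots> = (?I1 * X) *\<^sub>v z"
    unfolding x_def by (rule assoc_mult_mat_vec[OF I1 X' z, symmetric])
  also have "\<dots> = Q1 *\<^sub>v (R1 *\<^sub>v z)"
    unfolding Q1(4) using Q1 z by (intro assoc_mult_mat_vec) auto
  finally have a: "a = Q1 *\<^sub>v (R1 *\<^sub>v z)" .
  have "b = ?I2 *\<^sub>v x" unfolding xab bottom_block_mult_vec[OF ac bc] ..
  also have "\<dots> = (?I2 * X) *\<^sub>v z"
    unfolding x_def by (rule assoc_mult_mat_vec[OF I2 X' z, symmetric])
  also have "\<dots> = Q2 *\<^sub>v (R2 *\<^sub>v z)"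
    unfolding Q2(4) using Q2 z by (intro assoc_mult_mat_vec) auto
  finally have b: "b = Q2 *\<^sub>v (R2 *\<^sub>v z)" .
  have "defect Q1 v \<le> (v - sqrt 2 \<cdot>\<^sub>v a) \<bullet> (v - sqrt 2 \<cdot>\<^sub>v a)"
    using defect_le[OF Q1(1,2) v, of "sqrt 2 \<cdot>\<^sub>v (R1 *\<^sub>v z)"] Q1 z
    by (simp add: a mult_mat_vec[of Q1 n p])
  moreover have "defect Q2 u \<le> (u - sqrt 2 \<cdot>\<^sub>v b) \<bullet> (u - sqrt 2 \<cdot>\<^sub>v b)"
    using defect_le[OF Q2(1,2) u, of "sqrt 2 \<cdot>\<^sub>v (R2 *\<^sub>v z)"] Q2 z
    by (simp add: b mult_mat_vec[of Q2 m p])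
  moreover have "2 * ((q - x) \<bullet> (q - x))
      = (v - sqrt 2 \<cdot>\<^sub>v a) \<bullet> (v - sqrt 2 \<cdot>\<^sub>v a) + (u - sqrt 2 \<cdot>\<^sub>v b) \<bullet> (u - sqrt 2 \<cdot>\<^sub>v b)"
  proof -
    have "sqrt 2 \<cdot>\<^sub>v (q - x) = (v - sqrt 2 \<cdot>\<^sub>v a) @\<^sub>v (u - sqrt 2 \<cdot>\<^sub>v b)"
      unfolding q xab using v u ac bc by (intro eq_vecI) (auto simp: algebra_simps)
    moreover have "(sqrt 2 \<cdot>\<^sub>v (q - x)) \<bullet> (sqrt 2 \<cdot>\<^sub>v (q - x)) = 2 * ((q - x) \<bullet> (q - x))"
      using xc u v by (simp add: q mult.assoc[symmetric])
    ultimately show ?thesis by (metis scalar_prod_append_self)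
  qed
  ultimately show ?thesis by (simp add: x_def)
qed

lemma svd_diagonalizes:
  assumes M: "M \<in> carrier_mat p r" and svd: "is_svd M U S V"
  shows "U\<^sup>T * M * V = S"
proof -
  have U: "U \<in> carrier_mat p p" "U\<^sup>T * U = 1\<^sub>m p" and V: "V \<in> carrier_mat r r" "V\<^sup>T * V = 1\<^sub>m r"
    and S: "S \<in> carrier_mat p r" and Meq: "M = U * S * V\<^sup>T"
    using svd M by (auto simp: is_svd_def orthonormal_cols_def)
  have "U\<^sup>T * M = U\<^sup>T * (U * (S * V\<^sup>T))"
    unfolding Meq using U V S by (simp add: assoc_mult_mat[of U p p S r "V\<^sup>T" r])
  also have "\<dots> = (U\<^sup>T * U) * (S * V\<^sup>T)"
    using U V S by (intro assoc_mult_mat[symmetric]) auto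
  also have "\<dots> = S * V\<^sup>T" using U V S by simp
  finally have "U\<^sup>T * M * V = S * (V\<^sup>T * V)"
    using V S by (simp add: assoc_mult_mat[of S p r "V\<^sup>T" r V r])
  then show ?thesis using V S by simp
qed

lemma compression_change_basis:
  assumes A: "(A :: real mat) \<in> carrier_mat m n" and Q1: "Q1 \<in> carrier_mat n p" and Q2: "Q2 \<in> carrier_mat m p"
    and W1: "W1 \<in> carrier_mat p p" and W2: "W2 \<in> carrier_mat p p"
  shows "(Q2 * W2)\<^sup>T * A * (Q1 * W1) = W2\<^sup>T * (Q2\<^sup>T * A * Q1) * W1"
proof -
  have "(Q2 * W2)\<^sup>T * A * (Q1 * W1) = W2\<^sup>T * Q2\<^sup>T * A * (Q1 * W1)"
    using Q2 W2 by (simp add: transpose_mult)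
  also have "W2\<^sup>T * Q2\<^sup>T * A = W2\<^sup>T * (Q2\<^sup>T * A)"
    using Q2 W2 A by (intro assoc_mult_mat) auto
  also have "W2\<^sup>T * (Q2\<^sup>T * A) * (Q1 * W1) = W2\<^sup>T * (Q2\<^sup>T * A) * Q1 * W1"
    using Q1 Q2 W1 W2 A by (intro assoc_mult_mat[symmetric]) auto
  also have "W2\<^sup>T * (Q2\<^sup>T * A) * Q1 = W2\<^sup>T * (Q2\<^sup>T * A * Q1)"
    using Q1 Q2 W2 A by (intro assoc_mult_mat) auto
  finally show ?thesis .
qed

lemma compression_entry:
  assumes A: "(A :: real mat) \<in> carrier_mat m n" and T1: "T1 \<in> carrier_mat n p" and T2: "T2 \<in> carrier_mat m p"
    and i: "i < p"
  shows "(T2\<^sup>T * A * T1) $$ (i, i) = col T2 i \<bullet> (A *\<^sub>v col T1 i)"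
proof -
  have "(T2\<^sup>T * A * T1) *\<^sub>v unit_vec p i = T2\<^sup>T *\<^sub>v (A *\<^sub>v (T1 *\<^sub>v unit_vec p i))"
    using A T1 T2 by (intro mult3_mat_vec) auto
  moreover have "(T2\<^sup>T * A * T1) *\<^sub>v unit_vec p i = col (T2\<^sup>T * A * T1) i"
    using A T1 T2 i by (intro mult_unit_vec_col) auto
  moreover have "col (T2\<^sup>T * A * T1) i $ i = (T2\<^sup>T * A * T1) $$ (i, i)"
    using T1 T2 i by (intro index_col) auto
  ultimately have "(T2\<^sup>T * A * T1) $$ (i, i) = (T2\<^sup>T *\<^sub>v (A *\<^sub>v (T1 *\<^sub>v unit_vec p i))) $ i" by metis
  then show ?thesis using T2 i by (simp add: mult_unit_vec_col[OF T1 i])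
qed

section \<open>Convergence of the Ritz approximations\<close>

theorem theorem6p6:
  fixes m n p r nsv d :: nat
    and A U S V SA Q PSA P Qp Qperp E0 :: "real mat"
    and a b :: real
    and l :: "real \<Rightarrow> real"
    and \<phi> :: "real poly"
    and c :: "nat \<Rightarrow> nat"
    and lam \<gamma> \<sigma> :: "nat \<Rightarrow> real"
    and q u v :: "nat \<Rightarrow> real vec"
    and Qt R Q1 R1 Q2 R2 Ub St Vb Pk :: "nat \<Rightarrow> real mat"
    and \<sigma>t \<eta> :: "nat \<Rightarrow> nat \<Rightarrow> real"
    and ut vt :: "nat \<Rightarrow> nat \<Rightarrow> real vec"
    and \<alpha> :: "nat \<Rightarrow> real"
  \<comment> \<open>the matrix, its SVD and the interval\<close>
  assumes A: "A \<in> carrier_mat m n" and mn: "n \<le> m"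
    and svd: "is_svd A U S V"
    and ab: "0 < a" "a < b"
    and ab_sub: "{a..b} \<subseteq> {Min ((\<lambda>j. S $$ (j, j)) ` {..<n}) .. norm2_mat A}"
    and nsv: "nsv = card {j. j < n \<and> S $$ (j, j) \<in> {a..b}}"
    and SA: "SA = aug_mat A"
    and Q: "Q = aug_eigvecs U V"
    and PSA: "PSA = spectral_projector Q (aug_eigval S) a b"
  \<comment> \<open>the approximate projector\<close>
    and l: "l = (\<lambda>x. x / norm2_mat A)"
    and \<phi>: "\<phi> = jackson_step_poly d (l a) (l b)"
    and P: "P = eval_poly_mat \<phi> ((1 / norm2_mat A) \<cdot>\<^sub>m SA)"
  \<comment> \<open>labelling of the eigenpairs\<close>
    and c: "bij_betw c {..<m + n} {..<m + n}"
    and lam: "lam = (\<lambda>i. aug_eigval S (c i))"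
    and q: "q = (\<lambda>i. col Q (c i))"
    and \<gamma>: "\<gamma> = (\<lambda>i. poly \<phi> (l (lam i)))"
    and \<gamma>_dec: "\<And>i j. i \<le> j \<Longrightarrow> j < m + n \<Longrightarrow> \<gamma> j \<le> \<gamma> i"
    and \<sigma>: "\<sigma> = lam"
    and u: "u = (\<lambda>i. col U (c i))"
    and v: "v = (\<lambda>i. col V (c i))"
    and Qp: "Qp = mat_of_cols (m + n) (map q [0..<p])"
    and Qperp: "Qperp = mat_of_cols (m + n) (map q [p..<m + n])"
  \<comment> \<open>standing assumptions on the degree\<close>
    and close: "norm2_mat (PSA - P) < 1/4"
    and r: "r \<le> nsv"
    and in_ab: "c ` {..<nsv} = {j. j < n \<and> S $$ (j, j) \<in> {a..b}}"
    and inner: "\<And>i. i < r \<Longrightarrow> a < \<sigma> i \<and> \<sigma> i < b"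
    and ends: "\<And>i. r \<le> i \<Longrightarrow> i < nsv \<Longrightarrow> \<sigma> i \<in> {a, b}"
    and \<gamma>_range: "\<And>i. i < m + n \<Longrightarrow> 0 \<le> \<gamma> i \<and> \<gamma> i \<le> 1"
    and \<gamma>_inner: "\<And>i. i < r \<Longrightarrow> \<gamma> i > 3/4"
    and \<gamma>_ends: "\<And>i. r \<le> i \<Longrightarrow> i < nsv \<Longrightarrow> 1/4 < \<gamma> i \<and> \<gamma> i < 3/4"
    and \<gamma>_outer: "\<And>i. nsv \<le> i \<Longrightarrow> i < m + n \<Longrightarrow> \<gamma> i < 1/4"
    and p: "nsv \<le> p" "p < m + n"
    and lam_pos: "\<And>i. nsv \<le> i \<Longrightarrow> i < p \<Longrightarrow> lam i > 0"
  \<comment> \<open>the iteration\<close>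
    and Qt0: "Qt 0 \<in> carrier_mat (m + n) p" "orthonormal_cols (Qt 0)"
    and qr: "\<And>k. k \<ge> 1 \<Longrightarrow> is_thin_qr (P * Qt (k - 1)) (Qt k) (R k)"
    and qr1: "\<And>k. k \<ge> 1 \<Longrightarrow> is_thin_qr ((1\<^sub>m n @\<^sub>r 0\<^sub>m m n)\<^sup>T * Qt k) (Q1 k) (R1 k)"
    and qr2: "\<And>k. k \<ge> 1 \<Longrightarrow> is_thin_qr ((0\<^sub>m n m @\<^sub>r 1\<^sub>m m)\<^sup>T * Qt k) (Q2 k) (R2 k)"
    and svd_bar: "\<And>k. k \<ge> 1 \<Longrightarrow> is_svd ((Q2 k)\<^sup>T * A * Q1 k) (Ub k) (St k) (Vb k)"
    and \<sigma>t: "\<sigma>t = (\<lambda>k i. St k $$ (i, i))"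
    and ut: "ut = (\<lambda>k i. (Q2 k * Ub k) *\<^sub>v unit_vec p i)"
    and vt: "vt = (\<lambda>k i. (Q1 k * Vb k) *\<^sub>v unit_vec p i)"
    and same_order: "\<And>k. k \<ge> 1 \<Longrightarrow> \<exists>\<pi>. \<pi> permutes {..<p} \<and>
           (\<forall>i j. i \<le> j \<and> j < p \<longrightarrow> \<sigma> (\<pi> j) \<le> \<sigma> (\<pi> i) \<and> \<sigma>t k (\<pi> j) \<le> \<sigma>t k (\<pi> i))"
  \<comment> \<open>further assumptions\<close>
    and gap: "\<gamma> p < \<gamma> (p - 1)"
    and inv0: "invertible_mat (Qp\<^sup>T * Qt 0)"
    and invR: "\<And>k. k \<ge> 1 \<Longrightarrow> invertible_mat (R1 k) \<and> invertible_mat (R2 k)"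
    and E0: "E0 = (Qperp\<^sup>T * Qt 0) * the (mat_inverse (Qp\<^sup>T * Qt 0))"
  \<comment> \<open>quantities and hypotheses of the theorem itself\<close>
    and Pk: "\<And>k. k \<ge> 1 \<Longrightarrow>
           is_orthogonal_projector (m + n) (Pk k) (col_span (block_diag2 (Q1 k) (Q2 k)))"
    and \<alpha>: "\<alpha> = (\<lambda>k. norm2_mat (Pk k * SA * (1\<^sub>m (m + n) - Pk k)))"
    and simple: "\<And>i. i < nsv \<Longrightarrow> card {j. j < n \<and> S $$ (j, j) = \<sigma> i} = 1"
    and \<eta>: "\<eta> = (\<lambda>k i. Min ((\<lambda>j. \<bar>\<sigma> i - \<sigma>t k j\<bar>) ` ({..<p} - {i})))"
    and k: "k \<ge> 1" and i: "i < nsv" and \<eta>_nz: "\<eta> k i \<noteq> 0"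
  shows "(sin (acute_angle (u i) (ut k i)))\<^sup>2 + (sin (acute_angle (v i) (vt k i)))\<^sup>2
           \<le> 2 * (1 + (\<alpha> k)\<^sup>2 / (\<eta> k i)\<^sup>2) * (\<gamma> p / \<gamma> i) ^ (2 * k) * (norm2_mat E0)\<^sup>2
       \<and> \<bar>\<sigma> i - \<sigma>t k i\<bar>
           \<le> 2 * norm2_mat A * (1 + (\<alpha> k)\<^sup>2 / (\<eta> k i)\<^sup>2) * (\<gamma> p / \<gamma> i) ^ (2 * k) * (norm2_mat E0)\<^sup>2"
proof -
  have U: "U \<in> carrier_mat m m" "orthonormal_cols U"
    and V: "V \<in> carrier_mat n n" "orthonormal_cols V" and S: "S \<in> carrier_mat m n"
    using svd A by (auto simp: is_svd_def)
  have ip: "i < p" using i p by simp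
  have iN: "i < m + n" using ip p by simp

  define j where "j = c i"
  have j: "j < n" "S $$ (j, j) \<in> {a..b}" using in_ab i by (auto simp: j_def)
  have ui: "u i = col U j" and vi: "v i = col V j" by (simp_all add: u v j_def)
  have \<sigma>i: "\<sigma> i = S $$ (j, j)" using j S by (simp add: \<sigma> lam aug_eigval_def j_def)
  have \<sigma>0: "0 \<le> \<sigma> i" using j ab by (simp add: \<sigma>i)
  have uc: "u i \<in> carrier_vec m" "u i \<bullet> u i = 1"
    using U orthonormal_cols_iff[OF U(1)] j mn by (auto simp: ui)
  have vc: "v i \<in> carrier_vec n" "v i \<bullet> v i = 1"
    using V orthonormal_cols_iff[OF V(1)] j by (auto simp: vi)
  have Av: "A *\<^sub>v v i = \<sigma> i \<cdot>\<^sub>v u i" and Au: "A\<^sup>T *\<^sub>v u i = \<sigma> i \<cdot>\<^sub>v v i"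
    unfolding ui vi \<sigma>i using svd_singular_pair[OF A mn svd j(1)] by auto

  have Qc: "Q \<in> carrier_mat (m + n) (m + n)" and Qo: "orthonormal_cols Q"
    unfolding Q using U V mn by (auto intro: aug_eigvecs_carrier aug_eigvecs_orthonormal)
  have cN: "c l < m + n" if "l < m + n" for l using c that by (auto simp: bij_betw_def)
  \<comment> \<open>\<open>H\<close> is the eigenvector matrix with columns in the order of the labels.\<close>
  define H where "H = mat_of_cols (m + n) (map q [0..<m + n])"
  have Hc: "H \<in> carrier_mat (m + n) (m + n)" by (auto simp: H_def)
  have qc: "q l \<in> carrier_vec (m + n)" for l
    using carrier_matD(1)[OF Qc] by (auto simp: q intro: carrier_vecI)
  have colH: "col H l = q l" if "l < m + n" for l
    unfolding H_def using that qc by (subst col_mat_of_cols) auto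
  have Ho: "orthonormal_cols H"
    unfolding orthonormal_cols_iff[OF Hc]
  proof (intro allI impI)
    fix l l' assume l: "l < m + n" "l' < m + n"
    have "c l = c l' \<longleftrightarrow> l = l'" using c l by (auto simp: bij_betw_def inj_on_def)
    then show "col H l \<bullet> col H l' = (if l = l' then 1 else 0)"
      using Qo[unfolded orthonormal_cols_iff[OF Qc]] l cN by (simp add: colH q)
  qed
  have SAc: "SA \<in> carrier_mat (m + n) (m + n)"
    using aug_mat_carrier[OF A] by (simp add: SA add.commute)
  let ?M = "(1 / norm2_mat A) \<cdot>\<^sub>m SA"
  have Mc: "?M \<in> carrier_mat (m + n) (m + n)" using SAc by simp
  have Mt: "?M\<^sup>T = ?M"
  proof -
    have "?M\<^sup>T = (1 / norm2_mat A) \<cdot>\<^sub>m SA\<^sup>T" by (intro eq_matI) auto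
    then show ?thesis by (simp add: SA aug_mat_symmetric)
  qed
  have Pc: "P \<in> carrier_mat (m + n) (m + n)" using SAc by (simp add: P eval_poly_mat_def)
  have spec: "col H h \<bullet> (P *\<^sub>v x) = \<gamma> h * (col H h \<bullet> x)"
    if h: "h < m + n" and x: "x \<in> carrier_vec (m + n)" for h x
  proof -
    have "?M *\<^sub>v q h = (1 / norm2_mat A) \<cdot>\<^sub>v (SA *\<^sub>v q h)"
      using SAc qc[of h] by (intro eq_vecI) auto
    also have "SA *\<^sub>v q h = lam h \<cdot>\<^sub>v q h"
      unfolding q SA Q lam by (rule aug_mat_eigvec[OF A mn svd cN[OF h]])
    finally have "?M\<^sup>T *\<^sub>v q h = (lam h / norm2_mat A) \<cdot>\<^sub>v q h"
      unfolding Mt by (simp add: smult_smult_assoc)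
    from left_eigvec_eval_poly[OF Mc qc this x, of \<phi>]
    show ?thesis unfolding colH[OF h] P \<gamma> by (simp add: l)
  qed
  have mapH: "map (col H) [0..<p] = map q [0..<p]" "map (col H) [p..<m + n] = map q [p..<m + n]"
    using p colH by auto
  \<comment> \<open>The dichotomy at 3/4 and 1/4 gives in both cases that dividing by \<open>\<gamma> i\<close> is sound.\<close>
  have \<gamma>i: "0 < \<gamma> i"
    using \<gamma>_inner[of i] \<gamma>_ends[of i] i by (cases "i < r") auto
  have "\<exists>z \<in> carrier_vec p. (col H i - Qt k *\<^sub>v z) \<bullet> (col H i - Qt k *\<^sub>v z)
      \<le> (\<gamma> p / \<gamma> i) ^ (2 * k) * (norm2_mat E0)\<^sup>2"
  proof (rule subspace_iteration_error[OF Hc Ho Pc spec, where R = R])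
    show "invertible_mat ((mat_of_cols (m + n) (map (col H) [0..<p]))\<^sup>T * Qt 0)"
      unfolding mapH using inv0 by (simp add: Qp)
    show "E0 = ((mat_of_cols (m + n) (map (col H) [p..<m + n]))\<^sup>T * Qt 0)
      * the (mat_inverse ((mat_of_cols (m + n) (map (col H) [0..<p]))\<^sup>T * Qt 0))"
      unfolding mapH E0 Qp Qperp ..
  qed (use \<gamma>_dec \<gamma>_range p Qt0 qr ip \<gamma>i in auto)
  then obtain z where z: "z \<in> carrier_vec p"
    and zle: "(q i - Qt k *\<^sub>v z) \<bullet> (q i - Qt k *\<^sub>v z) \<le> (\<gamma> p / \<gamma> i) ^ (2 * k) * (norm2_mat E0)\<^sup>2"
    using colH[OF iN] by auto

  have Qtc: "Qt k \<in> carrier_mat (m + n) p" by (rule iterate_carrier[OF Pc Qt0(1) qr])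
  have Q1: "Q1 k \<in> carrier_mat n p" "orthonormal_cols (Q1 k)"
    using qr1[OF k] Qtc by (auto simp: is_thin_qr_def append_rows_def)
  have Q2: "Q2 k \<in> carrier_mat m p" "orthonormal_cols (Q2 k)"
    using qr2[OF k] Qtc by (auto simp: is_thin_qr_def append_rows_def)
  have qi: "q i = (1 / sqrt 2) \<cdot>\<^sub>v (v i @\<^sub>v u i)"
    using col_aug_eigvecs[OF U(1) V(1) mn, of j] j by (simp add: q Q ui vi j_def)
  have defect_bound: "defect (Q1 k) (v i) + defect (Q2 k) (u i)
      \<le> 2 * ((\<gamma> p / \<gamma> i) ^ (2 * k) * (norm2_mat E0)\<^sup>2)"
    using defect_blocks_le[OF vc(1) uc(1) Qtc z qr1[OF k] qr2[OF k] qi] zle by linarith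

  have Ab: "(Q2 k)\<^sup>T * A * Q1 k \<in> carrier_mat p p" using Q1 Q2 A by auto
  have Ub: "Ub k \<in> carrier_mat p p" "orthonormal_cols (Ub k)"
    and Vb: "Vb k \<in> carrier_mat p p" "orthonormal_cols (Vb k)"
    and St: "diagonal_mat (St k)" "\<And>l. l < p \<Longrightarrow> 0 \<le> \<sigma>t k l"
    using svd_bar[OF k] Q1 Q2 by (auto simp: is_svd_def \<sigma>t)
  \<comment> \<open>The columns of \<open>T1\<close> and \<open>T2\<close> are the Ritz vectors.\<close>
  define T1 where "T1 = Q1 k * Vb k"
  define T2 where "T2 = Q2 k * Ub k"
  have T1: "T1 \<in> carrier_mat n p" "orthonormal_cols T1"
    using Q1 Vb by (auto simp: T1_def intro: orthonormal_mult)
  have T2: "T2 \<in> carrier_mat m p" "orthonormal_cols T2"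
    using Q2 Ub by (auto simp: T2_def intro: orthonormal_mult)
  have D: "T2\<^sup>T * A * T1 = St k"
    unfolding T1_def T2_def compression_change_basis[OF A Q1(1) Q2(1) Vb(1) Ub(1)]
    by (rule svd_diagonalizes[OF Ab svd_bar[OF k]])
  have uti: "ut k i = col T2 i" and vti: "vt k i = col T1 i"
    using mult_unit_vec_col[OF T2(1) ip] mult_unit_vec_col[OF T1(1) ip]
    by (simp_all add: ut vt T1_def T2_def)
  have utc: "ut k i \<in> carrier_vec m" "ut k i \<bullet> ut k i = 1"
    using T2 orthonormal_cols_iff[OF T2(1)] ip by (auto simp: uti)
  have vtc: "vt k i \<in> carrier_vec n" "vt k i \<bullet> vt k i = 1"
    using T1 orthonormal_cols_iff[OF T1(1)] ip by (auto simp: vti)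
  have \<sigma>ti: "\<sigma>t k i = ut k i \<bullet> (A *\<^sub>v vt k i)"
    using compression_entry[OF A T1(1) T2(1) ip] by (simp add: D \<sigma>t uti vti)

  have "block_diag2 T1 T2 = block_diag2 (Q1 k) (Q2 k) * block_diag2 (Vb k) (Ub k)"
    unfolding T1_def T2_def using Q1 Q2 Ub Vb by (intro block_diag2_mult[symmetric]) auto
  then have span: "col_span (block_diag2 T1 T2) = col_span (block_diag2 (Q1 k) (Q2 k))"
    using Q1 Q2 Ub Vb
    by (simp add: col_span_mult_orthogonal[OF block_diag2_carrier block_diag2_carrier block_diag2_orthonormal])
  have "(\<Sum>l<p. (\<sigma> i - \<sigma>t k l)\<^sup>2 * ((col T1 l \<bullet> v i)\<^sup>2 + (col T2 l \<bullet> u i)\<^sup>2))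
    \<le> (norm2_mat (Pk k * aug_mat A * (1\<^sub>m (n + m) - Pk k)))\<^sup>2 * (defect T1 (v i) + defect T2 (u i))"
    using Pk[OF k] St
    by (intro ritz_components_bound[OF A T1 T2 D St(1) _ _ uc(1) vc(1) Av Au \<sigma>0])
       (auto simp: \<sigma>t span add.commute)
  then have comp: "(\<Sum>l<p. (\<sigma> i - \<sigma>t k l)\<^sup>2 * ((col T1 l \<bullet> v i)\<^sup>2 + (col T2 l \<bullet> u i)\<^sup>2))
    \<le> (\<alpha> k)\<^sup>2 * (defect T1 (v i) + defect T2 (u i))"
    by (simp add: \<alpha> SA add.commute)
  have sep: "(\<eta> k i)\<^sup>2 \<le> (\<sigma> i - \<sigma>t k l)\<^sup>2" if l: "l < p" "l \<noteq> i" for l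
  proof -
    have fin: "finite ((\<lambda>l. \<bar>\<sigma> i - \<sigma>t k l\<bar>) ` ({..<p} - {i}))" by simp
    \<comment> \<open>If \<open>p = 1\<close> the minimum is over the empty set, but then there is no such \<open>l\<close>.\<close>
    have ne: "(\<lambda>l. \<bar>\<sigma> i - \<sigma>t k l\<bar>) ` ({..<p} - {i}) \<noteq> {}" using l by auto
    have "\<eta> k i \<le> \<bar>\<sigma> i - \<sigma>t k l\<bar>" unfolding \<eta> using l fin by (intro Min_le) auto
    moreover have "0 \<le> \<eta> k i" unfolding \<eta> using Min_in[OF fin ne] by auto
    ultimately have "(\<eta> k i)\<^sup>2 \<le> \<bar>\<sigma> i - \<sigma>t k l\<bar>\<^sup>2" by (rule power_mono)
    then show ?thesis by simp
  qed
  \<comment> \<open>Both claims follow from the bound \<open>B\<close> on the sum of the squared sines.\<close>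
  define B where "B = 2 * (1 + (\<alpha> k)\<^sup>2 / (\<eta> k i)\<^sup>2) * (\<gamma> p / \<gamma> i) ^ (2 * k) * (norm2_mat E0)\<^sup>2"
  have "(1 - (ut k i \<bullet> u i)\<^sup>2) + (1 - (vt k i \<bullet> v i)\<^sup>2)
      \<le> (1 + (\<alpha> k)\<^sup>2 / (\<eta> k i)\<^sup>2) * (defect T1 (v i) + defect T2 (u i))"
    unfolding uti vti
    by (rule sin_sum_le_defect[OF T1(1) T2(1) uc(2) vc(2) ip comp sep \<eta>_nz])
  also have "defect T1 (v i) + defect T2 (u i) = defect (Q1 k) (v i) + defect (Q2 k) (u i)"
    unfolding T1_def T2_def
    using defect_mult_orthogonal[OF Q1(1) Vb vc(1)] defect_mult_orthogonal[OF Q2(1) Ub uc(1)] by simp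
  also have "(1 + (\<alpha> k)\<^sup>2 / (\<eta> k i)\<^sup>2) * \<dots> \<le> (1 + (\<alpha> k)\<^sup>2 / (\<eta> k i)\<^sup>2)
      * (2 * ((\<gamma> p / \<gamma> i) ^ (2 * k) * (norm2_mat E0)\<^sup>2))"
    using defect_bound by (intro mult_left_mono) auto
  also have "\<dots> = B" by (simp add: B_def)
  finally have sins: "(1 - (ut k i \<bullet> u i)\<^sup>2) + (1 - (vt k i \<bullet> v i)\<^sup>2) \<le> B" .
  have "(sin (acute_angle (u i) (ut k i)))\<^sup>2 + (sin (acute_angle (v i) (vt k i)))\<^sup>2 \<le> B"
    using sins
    unfolding sin_sq_acute_angle[OF uc utc] sin_sq_acute_angle[OF vc vtc]
      comm_scalar_prod[OF uc(1) utc(1)] comm_scalar_prod[OF vc(1) vtc(1)] .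
  moreover have "\<bar>\<sigma> i - \<sigma>t k i\<bar> \<le> norm2_mat A * B"
  proof -
    have "\<bar>\<sigma> i - \<sigma>t k i\<bar> \<le> norm2_mat A * ((1 - (ut k i \<bullet> u i)\<^sup>2) + (1 - (vt k i \<bullet> v i)\<^sup>2))"
      by (rule ritz_value_error[OF A uc vc utc vtc Av Au \<sigma>0 \<sigma>ti St(2)[OF ip]])
    also have "\<dots> \<le> norm2_mat A * B" using sins norm2_mat_nonneg by (intro mult_left_mono)
    finally show ?thesis .
  qed
  ultimately show ?thesis by (simp add: B_def ac_simps)
qed

end
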